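(* Let $(X,d_X)$ be a proper, non-compact $\mathrm{CAT}(-1)$ space and let $\Gamma$ be a discrete and cocompact subgroup of the isometries of $X$. Let $\Omega\subset\partial_\infty^{\max}(X\times X)$ be the set of all classes (modulo additive constants) of functions $(z,z')\mapsto\max\{\beta^{p}_{\xi}(z),\beta^{p'}_{\xi'}(z')\}$ with $p,p'\in X$, $\xi,\xi'\in\partial_\infty X$ and $\xi\neq\xi'$. Then the (diagonal) action of $\Gamma$ on $X\times X\cup\Omega$ is properly discontinuous and cocompact.
   Context: $\partial_\infty X$ is the ideal boundary of $X$ (equivalence classes of geodesic rays at bounded distance). For $\xi\in\partial_\infty X$ and $p\in X$, the Busemann function is $\beta_\xi^p(\cdot)=\lim_{t\to\infty}\bigl(d_X(\cdot,c(t))-t\bigr)$, where $c$ is the ray with $c(0)=p$, $c(\infty)=\xi$. On $X\times X$ consider the maximum metric $d_{\max}((x,y),(x',y'))=\max\{d_X(x,x'),d_X(y,y')\}$. Let $C_*$ be the space of continuous functions $X\times X\to\mathbb{R}$ (with the topology of uniform convergence on compact sets) modulo additive constants, and embed $X\times X$ in $C_*$ by $\iota(x,y)=[d_{\max}((x,y),\cdot)]$. The compactification $\overline{X\times X}^{\max}$ is the closure of $\iota(X\times X)$ in $C_*$, and $\partial_\infty^{\max}(X\times X)=\overline{X\times X}^{\max}\setminus\iota(X\times X)$. We identify $X\times X$ with $\iota(X\times X)$, and $X\times X\cup\Omega$ carries the subspace topology. Regular boundary points are those classes of functions $\max\{\beta^p_\xi(z),\beta^{p'}_{\xi'}(z')\}$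 with $\xi,\xi'\in\partial_\infty X$ arbitrary; for a fixed $o\in X$ they are parametrized by $\partial_\infty X\times\partial_\infty X\times\mathbb{R}$ via $[\max\{\beta^{o}_{\xi}(z),\beta^{o}_{\xi'}(z')+C\}]\mapsto(\xi,\xi',C)$, and $\Omega$ corresponds to $((\partial_\infty X\times\partial_\infty X)\setminus D)\times\mathbb{R}$, where $D$ is the diagonal. The diagonal action of $\Gamma$ on $X\times X$, $\gamma(x,y)=(\gamma x,\gamma y)$, extends to an action by homeomorphisms on $\overline{X\times X}^{\max}$, namely $\gamma[h]=[h\circ\gamma^{-1}]$. An action of $\Gamma$ on a space $Y$ is properly discontinuous if for every compact $K\subset Y$ the set $K\cap\gamma K$ is non-empty for only finitely many $\gamma\in\Gamma$; it is cocompact if there is a compact $K\subset Y$ with $Y=\Gamma K$. "$\Gamma$ discrete and cocompact" means that $\Gamma$ acts properly discontinuously and cocompactly on $X$. *)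

theory Defs
  imports "HOL-Analysis.Analysis" "HOL-Algebra.Group"
begin

section \<open>CAT(-1) spaces\<close>

definition geodesic_segment ::
    "'b set \<Rightarrow> ('b \<Rightarrow> 'b \<Rightarrow> real) \<Rightarrow> 'b \<Rightarrow> 'b \<Rightarrow> 'b set \<Rightarrow> bool" where
  "geodesic_segment M d x y S \<longleftrightarrow>
     (\<exists>c. c 0 = x \<and> c (d x y) = y \<and> c ` {0..d x y} = S \<and> S \<subseteq> M \<and>
        (\<forall>s\<in>{0..d x y}. \<forall>t\<in>{0..d x y}. d (c s) (c t) = \<bar>s - t\<bar>))"

text \<open>The hyperbolic plane (the model space of constant curvature -1) in the hyperboloid
  model: the upper sheet of \<open>x\<^sup>2 + y\<^sup>2 - t\<^sup>2 = -1\<close>, with \<open>cosh\<close> of the distance equal to minus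
  the Lorentz form.\<close>

definition hyp_plane :: "(real \<times> real \<times> real) set" where
  "hyp_plane = {(x, y, t). x\<^sup>2 + y\<^sup>2 - t\<^sup>2 = -1 \<and> t > 0}"

definition hyp_dist :: "real \<times> real \<times> real \<Rightarrow> real \<times> real \<times> real \<Rightarrow> real" where
  "hyp_dist = (\<lambda>(x, y, t) (x', y', t'). arcosh (t * t' - x * x' - y * y'))"

text \<open>The comparison inequality is stated for points on the two sides issuing from the vertex
  \<open>x\<close>. As \<open>x\<close>, \<open>y\<close>, \<open>z\<close> are arbitrary, relabelling the vertices gives it for any two distinct
  sides; for two points on the same side both distances agree anyway.\<close>

definition CAT_minus_one :: "'b set \<Rightarrow> ('b \<Rightarrow> 'b \<Rightarrow> real) \<Rightarrow> bool" where
  "CAT_minus_one M d \<longleftrightarrow>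
     (\<forall>x\<in>M. \<forall>y\<in>M. \<exists>S. geodesic_segment M d x y S) \<and>
     (\<forall>x\<in>M. \<forall>y\<in>M. \<forall>z\<in>M. \<forall>S T.
        geodesic_segment M d x y S \<longrightarrow> geodesic_segment M d x z T \<longrightarrow>
        (\<forall>x'\<in>hyp_plane. \<forall>y'\<in>hyp_plane. \<forall>z'\<in>hyp_plane. \<forall>S' T'.
           hyp_dist x' y' = d x y \<longrightarrow> hyp_dist y' z' = d y z \<longrightarrow> hyp_dist x' z' = d x z \<longrightarrow>
           geodesic_segment hyp_plane hyp_dist x' y' S' \<longrightarrow>
           geodesic_segment hyp_plane hyp_dist x' z' T' \<longrightarrow>
           (\<forall>p\<in>S. \<forall>q\<in>T. \<forall>p'\<in>S'. \<forall>q'\<in>T'.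
              hyp_dist x' p' = d x p \<longrightarrow> hyp_dist x' q' = d x q \<longrightarrow>
              d p q \<le> hyp_dist p' q')))"


section \<open>Ideal boundary and Busemann functions\<close>

text \<open>Rays have domain \<open>[0, \<infinity>)\<close>; extensionality makes the ray from a given point to a given
  ideal point unique as a HOL function.\<close>

definition geodesic_ray :: "(real \<Rightarrow> 'a::metric_space) \<Rightarrow> bool" where
  "geodesic_ray c \<longleftrightarrow>
     c \<in> extensional {0..} \<and> (\<forall>s\<ge>0. \<forall>t\<ge>0. dist (c s) (c t) = \<bar>s - t\<bar>)"

definition asymptotic_rays :: "((real \<Rightarrow> 'a::metric_space) \<times> (real \<Rightarrow> 'a)) set" where
  "asymptotic_rays =
     {(c, c'). geodesic_ray c \<and> geodesic_ray c' \<and> (\<exists>B. \<forall>t\<ge>0. dist (c t) (c' t) \<le> B)}"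

definition ideal_boundary :: "(real \<Rightarrow> 'a::metric_space) set set" where
  "ideal_boundary = {c. geodesic_ray c} // asymptotic_rays"

definition ray_busemann :: "(real \<Rightarrow> 'a::metric_space) \<Rightarrow> 'a \<Rightarrow> real" where
  "ray_busemann c x = Lim at_top (\<lambda>t. dist x (c t) - t)"

definition busemann :: "'a::metric_space \<Rightarrow> (real \<Rightarrow> 'a) set \<Rightarrow> 'a \<Rightarrow> real" where
  "busemann p \<xi> = ray_busemann (THE c. geodesic_ray c \<and> c 0 = p \<and> c \<in> \<xi>)"


section \<open>Continuous functions modulo constants\<close>

definition compact_convergence :: "('b::topological_space \<Rightarrow> real) topology" where
  "compact_convergence = topology (\<lambda>U. U \<subseteq> {f. continuous_on UNIV f} \<and>
     (\<forall>f\<in>U. \<exists>K e. compact K \<and> e > 0 \<and>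
        {g. continuous_on UNIV g \<and> (\<forall>x\<in>K. \<bar>g x - f x\<bar> < e)} \<subseteq> U))"

definition mod_const :: "('b \<Rightarrow> real) \<Rightarrow> ('b \<Rightarrow> real) set" where
  "mod_const f = {g. \<exists>a. \<forall>x. g x = f x + a}"

lemma mod_const_add: "mod_const (\<lambda>x. f x + a) = mod_const f"
proof (intro equalityI subsetI)
  fix g assume "g \<in> mod_const (\<lambda>x. f x + a)"
  then obtain b where "\<And>x. g x = f x + a + b" by (auto simp: mod_const_def)
  then show "g \<in> mod_const f" by (auto simp: mod_const_def intro!: exI[of _ "a + b"])
next
  fix g assume "g \<in> mod_const f"
  then obtain b where "\<And>x. g x = f x + b" by (auto simp: mod_const_def)
  then show "g \<in> mod_const (\<lambda>x. f x + a)"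
    by (auto simp: mod_const_def intro!: exI[of _ "b - a"])
qed

text \<open>The quotient topology on the set of classes (see \<open>quotient_map_mod_const\<close> below).\<close>

definition Cstar :: "('b::topological_space \<Rightarrow> real) set topology" where
  "Cstar = topology (\<lambda>V. V \<subseteq> mod_const ` {f. continuous_on UNIV f} \<and>
     openin compact_convergence {f. continuous_on UNIV f \<and> mod_const f \<in> V})"

lemma openin_compact_convergence:
  fixes U :: "('b::topological_space \<Rightarrow> real) set"
  shows "openin compact_convergence U \<longleftrightarrow> U \<subseteq> {f. continuous_on UNIV f} \<and>
     (\<forall>f\<in>U. \<exists>K e. compact K \<and> e > 0 \<and>
        {g. continuous_on UNIV g \<and> (\<forall>x\<in>K. \<bar>g x - f x\<bar> < e)} \<subseteq> U)"
proof -
  let ?N = "\<lambda>(f :: 'b \<Rightarrow> real) K (e :: real). {g. continuous_on UNIV g \<and> (\<forall>x\<in>K. \<bar>g x - f x\<bar> < e)}"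
  let ?P = "\<lambda>U :: ('b \<Rightarrow> real) set. U \<subseteq> {f. continuous_on UNIV f} \<and>
     (\<forall>f\<in>U. \<exists>K e. compact K \<and> e > 0 \<and> ?N f K e \<subseteq> U)"
  have "istopology ?P"
    unfolding istopology_def
  proof (intro conjI allI impI)
    fix S T :: "('b \<Rightarrow> real) set" assume S: "?P S" and T: "?P T"
    show "S \<inter> T \<subseteq> {f. continuous_on UNIV f}" using S by blast
    show "\<forall>f\<in>S \<inter> T. \<exists>K e. compact K \<and> e > 0 \<and> ?N f K e \<subseteq> S \<inter> T"
    proof
      fix f assume f: "f \<in> S \<inter> T"
      obtain K e where K: "compact K" "e > 0" "?N f K e \<subseteq> S" using S f by auto
      obtain L d where L: "compact L" "d > 0" "?N f L d \<subseteq> T" using T f by auto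
      have "?N f (K \<union> L) (min e d) \<subseteq> ?N f K e \<inter> ?N f L d" by auto
      with K L show "\<exists>K e. compact K \<and> e > 0 \<and> ?N f K e \<subseteq> S \<inter> T"
        by (intro exI[of _ "K \<union> L"] exI[of _ "min e d"] conjI compact_Un) auto
    qed
  next
    fix \<K> :: "('b \<Rightarrow> real) set set" assume *: "\<forall>S\<in>\<K>. ?P S"
    then show "\<Union>\<K> \<subseteq> {f. continuous_on UNIV f}" by blast
    show "\<forall>f\<in>\<Union>\<K>. \<exists>K e. compact K \<and> e > 0 \<and> ?N f K e \<subseteq> \<Union>\<K>"
    proof
      fix f assume "f \<in> \<Union>\<K>"
      then obtain S where S: "S \<in> \<K>" "f \<in> S" by blast
      then obtain K e where "compact K" "e > 0" "?N f K e \<subseteq> S" using * by meson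
      with S show "\<exists>K e. compact K \<and> e > 0 \<and> ?N f K e \<subseteq> \<Union>\<K>" by blast
    qed
  qed
  then show ?thesis
    unfolding compact_convergence_def by (subst topology_inverse') auto
qed

lemma topspace_compact_convergence: "topspace compact_convergence = {f. continuous_on UNIV f}"
proof
  show "topspace compact_convergence \<subseteq> {f. continuous_on UNIV f}"
    using openin_topspace openin_compact_convergence by blast
  have "openin compact_convergence {f. continuous_on UNIV f}"
    unfolding openin_compact_convergence
    by (auto intro!: exI[of _ "{}"] exI[of _ "1::real"])
  then show "{f. continuous_on UNIV f} \<subseteq> topspace compact_convergence"
    by (rule openin_subset)
qed

lemma openin_Cstar:
  fixes V :: "('b::topological_space \<Rightarrow> real) set set"
  shows "openin Cstar V \<longleftrightarrow> V \<subseteq> mod_const ` {f. continuous_on UNIV f} \<and>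
     openin compact_convergence {f. continuous_on UNIV f \<and> mod_const f \<in> V}"
proof -
  let ?Q = "\<lambda>V :: ('b \<Rightarrow> real) set set. {f. continuous_on UNIV f \<and> mod_const f \<in> V}"
  have Int: "?Q (S \<inter> T) = ?Q S \<inter> ?Q T" for S T by blast
  have Un: "?Q (\<Union>\<K>) = \<Union>(?Q ` \<K>)" for \<K> by blast
  have "istopology (\<lambda>V. V \<subseteq> mod_const ` {f. continuous_on UNIV f} \<and>
          openin compact_convergence (?Q V))"
    unfolding istopology_def Int Un by (auto intro!: openin_Int openin_Union)
  then show ?thesis
    unfolding Cstar_def by (subst topology_inverse') auto
qed

lemma topspace_Cstar: "topspace Cstar = mod_const ` {f. continuous_on UNIV f}"
proof
  show "topspace Cstar \<subseteq> mod_const ` {f. continuous_on UNIV f}"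
    using openin_topspace openin_Cstar by blast
  have "{f. continuous_on UNIV f \<and> mod_const f \<in> mod_const ` {f. continuous_on UNIV f}}
      = topspace (compact_convergence :: ('a \<Rightarrow> real) topology)"
    by (auto simp: topspace_compact_convergence)
  then have "openin Cstar (mod_const ` {f :: 'a \<Rightarrow> real. continuous_on UNIV f})"
    unfolding openin_Cstar by simp
  then show "mod_const ` {f :: 'a \<Rightarrow> real. continuous_on UNIV f} \<subseteq> topspace Cstar"
    by (rule openin_subset)
qed

lemma quotient_map_mod_const: "quotient_map compact_convergence Cstar mod_const"
  unfolding quotient_map_def topspace_compact_convergence topspace_Cstar openin_Cstar by simp


section \<open>The compactification of the product by the maximum metric\<close>

definition max_dist :: "'a::metric_space \<times> 'a \<Rightarrow> 'a \<times> 'a \<Rightarrow> real" where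
  "max_dist p q = max (dist (fst p) (fst q)) (dist (snd p) (snd q))"

definition max_embed :: "'a::metric_space \<times> 'a \<Rightarrow> ('a \<times> 'a \<Rightarrow> real) set" where
  "max_embed p = mod_const (max_dist p)"

definition max_compactification :: "('a::metric_space \<times> 'a \<Rightarrow> real) set set" where
  "max_compactification = Cstar closure_of range max_embed"

definition max_boundary :: "('a::metric_space \<times> 'a \<Rightarrow> real) set set" where
  "max_boundary = max_compactification - range max_embed"

text \<open>This set is automatically contained in \<open>max_boundary\<close>: see \<open>ray_class_in_max_boundary\<close>
  at the end.\<close>

definition Omega :: "('a::metric_space \<times> 'a \<Rightarrow> real) set set" where
  "Omega = {mod_const (\<lambda>(z, z'). max (busemann p \<xi> z) (busemann p' \<xi>' z')) | p p' \<xi> \<xi>'.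
     \<xi> \<in> ideal_boundary \<and> \<xi>' \<in> ideal_boundary \<and> \<xi> \<noteq> \<xi>'}"


section \<open>Group actions\<close>

definition isometry_group :: "('a::metric_space \<Rightarrow> 'a) monoid" where
  "isometry_group =
     \<lparr>carrier = {f. surj f \<and> (\<forall>x y. dist (f x) (f y) = dist x y)}, mult = (\<circ>), one = id\<rparr>"

text \<open>\<open>[h] \<mapsto> [h \<circ> \<gamma>\<inverse>]\<close> for the diagonal action, applied to all representatives of the class.\<close>

definition diag_action ::
    "('a \<Rightarrow> 'a) \<Rightarrow> ('a \<times> 'a \<Rightarrow> real) set \<Rightarrow> ('a \<times> 'a \<Rightarrow> real) set" where
  "diag_action \<gamma> F = (\<lambda>h. h \<circ> map_prod (inv_into UNIV \<gamma>) (inv_into UNIV \<gamma>)) ` F"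

definition properly_discontinuous ::
    "'b topology \<Rightarrow> 'g set \<Rightarrow> ('g \<Rightarrow> 'b \<Rightarrow> 'b) \<Rightarrow> bool" where
  "properly_discontinuous Y G act \<longleftrightarrow>
     (\<forall>K. compactin Y K \<longrightarrow> finite {g \<in> G. K \<inter> act g ` K \<noteq> {}})"

definition cocompact :: "'b topology \<Rightarrow> 'g set \<Rightarrow> ('g \<Rightarrow> 'b \<Rightarrow> 'b) \<Rightarrow> bool" where
  "cocompact Y G act \<longleftrightarrow> (\<exists>K. compactin Y K \<and> topspace Y = (\<Union>g\<in>G. act g ` K))"

lemma group_isometry_group: "group isometry_group"
proof (rule groupI)
  fix f assume f: "f \<in> carrier isometry_group"
  have inj: "inj f"
    using f by (auto simp: isometry_group_def inj_def) (metis dist_eq_0_iff)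
  have "dist (inv_into UNIV f x) (inv_into UNIV f y) = dist x y" for x y
    using f by (simp add: isometry_group_def) (metis surj_f_inv_f)
  then show "\<exists>g\<in>carrier isometry_group. g \<otimes>\<^bsub>isometry_group\<^esub> f = \<one>\<^bsub>isometry_group\<^esub>"
    using inj by (intro bexI[of _ "inv_into UNIV f"])
      (auto simp: isometry_group_def inj_imp_surj_inv)
qed (auto simp: isometry_group_def comp_surj o_assoc surj_def, metis)

lemma diag_action_mod_const:
  "diag_action \<gamma> (mod_const h) =
     mod_const (h \<circ> map_prod (inv_into UNIV \<gamma>) (inv_into UNIV \<gamma>))"
proof -
  let ?i = "map_prod (inv_into UNIV \<gamma>) (inv_into UNIV \<gamma>)"
  have "g \<in> (\<lambda>h. h \<circ> ?i) ` mod_const h" if "\<forall>x. g x = (h \<circ> ?i) x + a" for g a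
    by (rule image_eqI[of _ _ "\<lambda>x. h x + a"]) (use that in \<open>auto simp: mod_const_def fun_eq_iff\<close>)
  then show ?thesis
    unfolding diag_action_def mod_const_def by auto
qed

lemma diag_action_max_embed:
  assumes "\<gamma> \<in> carrier isometry_group"
  shows "diag_action \<gamma> (max_embed (x, y)) = max_embed (\<gamma> x, \<gamma> y)"
proof -
  have "dist x (inv_into UNIV \<gamma> z) = dist (\<gamma> x) z" for x z
    using assms by (simp add: isometry_group_def) (metis surj_f_inv_f)
  then have "max_dist (x, y) \<circ> map_prod (inv_into UNIV \<gamma>) (inv_into UNIV \<gamma>)
      = max_dist (\<gamma> x, \<gamma> y)"
    by (auto simp: max_dist_def fun_eq_iff)
  then show ?thesis
    by (simp add: max_embed_def diag_action_mod_const)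
qed


section \<open>Regular points lie in the boundary\<close>

lemma ray_busemann_tendsto:
  assumes "geodesic_ray c"
  shows "((\<lambda>t. dist x (c t) - t) \<longlongrightarrow> ray_busemann c x) at_top"
proof -
  let ?g = "\<lambda>t. dist x (c t) - t"
  have d: "dist (c s) (c t) = \<bar>s - t\<bar>" if "s \<ge> 0" "t \<ge> 0" for s t
    using assms that by (auto simp: geodesic_ray_def)
  have mono: "?g t \<le> ?g s" if "0 \<le> s" "s \<le> t" for s t
    using dist_triangle[of x "c t" "c s"] d[of s t] that by (simp add: dist_commute)
  have bdd: "bdd_below (?g ` {0..})"
  proof (rule bdd_belowI2)
    fix t :: real assume "t \<in> {0..}"
    then show "- dist x (c 0) \<le> ?g t"
      using dist_triangle[of "c 0" "c t" x] d[of 0 t] by (simp add: dist_commute)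
  qed
  have "(?g \<longlongrightarrow> (INF t\<in>{0..}. ?g t)) at_top"
  proof (rule decreasing_tendsto)
    show "\<forall>\<^sub>F t in at_top. (INF t\<in>{0..}. ?g t) \<le> ?g t"
      using eventually_ge_at_top[of 0] by eventually_elim (auto intro!: cINF_lower bdd)
  next
    fix a assume "(INF t\<in>{0..}. ?g t) < a"
    then obtain s where s: "s \<ge> 0" "?g s < a"
      using bdd by (subst (asm) cINF_less_iff) auto
    show "\<forall>\<^sub>F t in at_top. ?g t < a"
      using eventually_ge_at_top[of s]
      by eventually_elim (use mono s in \<open>fastforce intro: le_less_trans\<close>)
  qed
  then show ?thesis
    unfolding ray_busemann_def using tendsto_Lim trivial_limit_at_top_linorder by metis
qed

lemma ray_busemann_lipschitz:
  assumes "geodesic_ray c"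
  shows "\<bar>ray_busemann c x - ray_busemann c y\<bar> \<le> dist x y"
proof -
  have le: "ray_busemann c x \<le> ray_busemann c y + dist x y" for x y
  proof (rule tendsto_le[OF trivial_limit_at_top_linorder])
    show "((\<lambda>t. dist y (c t) - t + dist x y) \<longlongrightarrow> ray_busemann c y + dist x y) at_top"
      by (intro tendsto_intros ray_busemann_tendsto assms)
    show "((\<lambda>t. dist x (c t) - t) \<longlongrightarrow> ray_busemann c x) at_top"
      by (intro ray_busemann_tendsto assms)
    show "\<forall>\<^sub>F t in at_top. dist x (c t) - t \<le> dist y (c t) - t + dist x y"
    proof (rule always_eventually, rule allI)
      fix t show "dist x (c t) - t \<le> dist y (c t) - t + dist x y"
        using dist_triangle[of x "c t" y] by simp
    qed
  qed
  show ?thesis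
    using le[of x y] le[of y x] by (auto simp: dist_commute abs_le_iff)
qed

lemma ray_busemann_uniform:
  assumes c: "geodesic_ray c" and K: "compact K" and e: "e > 0"
  shows "\<forall>\<^sub>F t in at_top. \<forall>x\<in>K. \<bar>dist x (c t) - t - ray_busemann c x\<bar> < e"
proof -
  have "K \<subseteq> (\<Union>k\<in>K. ball k (e/3))" using e by auto
  then obtain N where N: "finite N" "N \<subseteq> K" "K \<subseteq> (\<Union>k\<in>N. ball k (e/3))"
    using compactE_image[OF K, of K "\<lambda>k. ball k (e/3)"] by (metis open_ball)
  have "\<forall>\<^sub>F t in at_top. \<bar>dist k (c t) - t - ray_busemann c k\<bar> < e/3" for k
    using tendstoD[OF ray_busemann_tendsto[OF c, of k], of "e/3"] e
    by (simp add: dist_real_def)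
  then have "\<forall>\<^sub>F t in at_top. \<forall>k\<in>N. \<bar>dist k (c t) - t - ray_busemann c k\<bar> < e/3"
    using N(1) by (intro eventually_ball_finite) auto
  then show ?thesis
  proof eventually_elim
    case (elim t)
    show ?case
    proof
      fix x assume "x \<in> K"
      then obtain k where k: "k \<in> N" "dist k x < e/3" using N by auto
      have "\<bar>dist x (c t) - dist k (c t)\<bar> \<le> dist k x"
        using dist_triangle[of x "c t" k] dist_triangle[of k "c t" x]
        by (auto simp: dist_commute abs_le_iff)
      moreover have "\<bar>ray_busemann c k - ray_busemann c x\<bar> \<le> dist k x"
        by (rule ray_busemann_lipschitz[OF c])
      moreover have "\<bar>dist k (c t) - t - ray_busemann c k\<bar> < e/3" using elim k by auto
      ultimately show "\<bar>dist x (c t) - t - ray_busemann c x\<bar> < e" using k by linarith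
    qed
  qed
qed

lemma ray_busemann_on_ray:
  assumes "geodesic_ray c" "s \<ge> 0"
  shows "ray_busemann c (c s) = - s"
proof -
  have "\<forall>\<^sub>F t in at_top. - s = dist (c s) (c t) - t"
    using eventually_ge_at_top[of s]
    by eventually_elim (use assms in \<open>auto simp: geodesic_ray_def\<close>)
  then have "((\<lambda>t. dist (c s) (c t) - t) \<longlongrightarrow> - s) at_top"
    by (rule tendsto_eventually[OF eventually_mono]) simp
  then show ?thesis
    using tendsto_unique[OF trivial_limit_at_top_linorder ray_busemann_tendsto[OF assms(1)]]
    by blast
qed

lemma ray_class_in_max_boundary:
  fixes c c' :: "real \<Rightarrow> 'a::metric_space"
  assumes c: "geodesic_ray c" and c': "geodesic_ray c'"
  shows "mod_const (\<lambda>(z, z'). max (ray_busemann c z) (ray_busemann c' z')) \<in> max_boundary"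
proof -
  define f where "f = (\<lambda>(z, z'). max (ray_busemann c z) (ray_busemann c' z'))"
  have cont: "continuous_on UNIV (ray_busemann b)" if "geodesic_ray b" for b :: "real \<Rightarrow> 'a"
    unfolding continuous_on_iff dist_real_def
    using ray_busemann_lipschitz[OF that] by (metis le_less_trans)
  have f_cont: "continuous_on UNIV f"
    unfolding f_def case_prod_unfold
    by (intro continuous_intros continuous_on_compose2[OF cont[OF c]]
          continuous_on_compose2[OF cont[OF c']]) auto
  have "mod_const f \<in> max_compactification"
    unfolding max_compactification_def in_closure_of
  proof (intro conjI allI impI)
    show "mod_const f \<in> topspace Cstar" using f_cont by (auto simp: topspace_Cstar)
    fix V assume "mod_const f \<in> V \<and> openin Cstar V"
    then have V: "mod_const f \<in> V"
      "openin compact_convergence {f. continuous_on UNIV f \<and> mod_const f \<in> V}"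
      by (auto simp: openin_Cstar)
    then obtain K e where K: "compact K" "e > 0"
      "{g. continuous_on UNIV g \<and> (\<forall>x\<in>K. \<bar>g x - f x\<bar> < e)}
         \<subseteq> {f. continuous_on UNIV f \<and> mod_const f \<in> V}"
      using f_cont unfolding openin_compact_convergence by blast
    have "compact (fst ` K)" "compact (snd ` K)"
      using K(1) by (auto intro!: compact_continuous_image continuous_intros)
    then have "\<forall>\<^sub>F t in at_top. (\<forall>x\<in>fst ` K. \<bar>dist x (c t) - t - ray_busemann c x\<bar> < e) \<and>
        (\<forall>x\<in>snd ` K. \<bar>dist x (c' t) - t - ray_busemann c' x\<bar> < e)"
      by (intro eventually_conj ray_busemann_uniform c c' K(2))
    then obtain t where t: "\<forall>x\<in>fst ` K. \<bar>dist x (c t) - t - ray_busemann c x\<bar> < e"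
        "\<forall>x\<in>snd ` K. \<bar>dist x (c' t) - t - ray_busemann c' x\<bar> < e"
      using eventually_happens'[OF trivial_limit_at_top_linorder] by blast
    define g where "g = (\<lambda>q. max_dist (c t, c' t) q + (- t))"
    have "continuous_on UNIV g"
      unfolding g_def max_dist_def by (intro continuous_intros)
    moreover have "\<forall>x\<in>K. \<bar>g x - f x\<bar> < e"
    proof
      fix x assume "x \<in> K"
      then have "\<bar>dist (fst x) (c t) - t - ray_busemann c (fst x)\<bar> < e"
          "\<bar>dist (snd x) (c' t) - t - ray_busemann c' (snd x)\<bar> < e"
        using t by auto
      then show "\<bar>g x - f x\<bar> < e"
        unfolding g_def f_def max_dist_def case_prod_unfold fst_conv snd_conv
          dist_commute[of "c t"] dist_commute[of "c' t"] by linarith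
    qed
    ultimately have "mod_const g \<in> V" using K(3) by blast
    moreover have "mod_const g = max_embed (c t, c' t)"
      unfolding max_embed_def g_def by (rule mod_const_add)
    ultimately show "\<exists>y. y \<in> range max_embed \<and> y \<in> V" by blast
  qed
  moreover have "mod_const f \<notin> range max_embed"
  proof
    assume "mod_const f \<in> range max_embed"
    then obtain p where p: "mod_const f = mod_const (max_dist p)"
      by (auto simp: max_embed_def)
    have "f \<in> mod_const f" by (auto simp: mod_const_def intro: exI[of _ 0])
    then obtain a where a: "\<And>q. f q = max_dist p q + a"
      unfolding p by (auto simp: mod_const_def)
    have "f (c (1 + \<bar>a\<bar>), c' (1 + \<bar>a\<bar>)) = - (1 + \<bar>a\<bar>)"
      by (simp add: f_def ray_busemann_on_ray c c')
    moreover have "max_dist p q \<ge> 0" for q by (simp add: max_dist_def le_max_iff_disj)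
    ultimately show False using a by (smt (verit))
  qed
  ultimately show ?thesis by (simp add: max_boundary_def f_def)
qed

end

theory Submission
  imports Defs "HOL-Real_Asymp.Real_Asymp"
begin



text \<open>
  Restrict a function on the product to the diagonal. For the distance function of a pair \<open>(x, y)\<close> this
  gives \<open>max (dist x w) (dist y w)\<close>, whose minimum is attained at the midpoint of \<open>x\<close> and \<open>y\<close>; for a
  point of \<open>Omega\<close> it gives the maximum of two Busemann functions, whose minimum is attained on the geodesic
  line between the two distinct ideal points. Sending a class to its minimum is equivariant, and it is
  proper: classes whose minimum lies in a ball form a relatively compact set. Both assertions are then
  pulled back from the action of \<open>\<Gamma>\<close> on the space itself.

  To avoid showing that the minimum depends continuously on the class, the argument works with near minima.
  The set \<open>limit_classes z R\<close> consists of the limits of distance functions of pairs which at \<open>(z, z)\<close>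
  exceed their diagonal minimum by at most \<open>R\<close>. It is compact (\<open>compactin_limit_classes\<close>), it is
  contained in the product together with \<open>Omega\<close> (\<open>limit_classes_subset\<close>), and every class there belongs to
  \<open>limit_classes z 1\<close> for some \<open>z\<close> (\<open>limit_classes_exhaust\<close>). Cocompactness follows, since \<open>z\<close> can be
  moved to a fixed ball by \<open>\<Gamma>\<close>.

  For proper discontinuity, a compact set of classes is covered by finitely many of the open sets
  \<open>descends_inside u n\<close>, hence the diagonal values of its members are bounded below uniformly, relative to
  the value at \<open>u\<close>. A class in the compact set and in its translate by \<open>g\<close> has near minima at \<open>u\<close> and
  at \<open>g u\<close>. By \<open>limit_class_midpoint\<close> the value at the midpoint of two near minima drops by about half of
  their distance, so this distance is bounded, and only finitely many \<open>g\<close> remain.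

  The curvature condition enters only through \<open>Stewart_inequality\<close>, which bounds the distance from a point
  to a geodesic segment in terms of the distances to its ends. It yields the drop at midpoints, the
  uniqueness of rays, the linear divergence of non-asymptotic rays, and the convergence of distance functions
  to Busemann functions.
\<close>

section \<open>The Stewart inequality of a CAT(-1) space\<close>

definition isometric_path :: "real \<Rightarrow> (real \<Rightarrow> 'a::metric_space) \<Rightarrow> bool" where
  "isometric_path a c \<longleftrightarrow> (\<forall>s\<in>{0..a}. \<forall>t\<in>{0..a}. dist (c s) (c t) = \<bar>s - t\<bar>)"

text \<open>Polar coordinates of the hyperboloid about its vertex \<open>(0, 0, 1)\<close>: the point at signed
  distance \<open>s\<close> in the unit direction \<open>(u, v)\<close>.\<close>

definition hyp_polar :: "real \<Rightarrow> real \<Rightarrow> real \<Rightarrow> real \<times> real \<times> real" where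
  "hyp_polar u v s = (sinh s * u, sinh s * v, cosh s)"

lemma hyp_polar_in_hyp_plane:
  assumes "u\<^sup>2 + v\<^sup>2 = 1"
  shows "hyp_polar u v s \<in> hyp_plane"
proof -
  have "(sinh s * u)\<^sup>2 + (sinh s * v)\<^sup>2 = (sinh s)\<^sup>2 * (u\<^sup>2 + v\<^sup>2)"
    by (simp add: power_mult_distrib algebra_simps)
  then show ?thesis
    using assms by (simp add: hyp_polar_def hyp_plane_def cosh_square_eq)
qed

lemma hyp_dist_polar:
  "hyp_dist (hyp_polar u v s) (hyp_polar u' v' t)
     = arcosh (cosh s * cosh t - sinh s * sinh t * (u * u' + v * v'))"
  by (simp add: hyp_polar_def hyp_dist_def algebra_simps)

lemma hyp_dist_polar_same:
  assumes "u\<^sup>2 + v\<^sup>2 = 1"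
  shows "hyp_dist (hyp_polar u v s) (hyp_polar u v t) = \<bar>s - t\<bar>"
proof -
  have "u * u + v * v = 1" using assms by (simp add: power2_eq_square)
  then have "hyp_dist (hyp_polar u v s) (hyp_polar u v t) = arcosh (cosh (s - t))"
    by (simp add: hyp_dist_polar cosh_diff)
  also have "cosh (s - t) = cosh \<bar>s - t\<bar>" by simp
  finally show ?thesis using arcosh_cosh_real[of "\<bar>s - t\<bar>"] by simp
qed

lemma geodesic_segment_hyp_polar:
  assumes "u\<^sup>2 + v\<^sup>2 = 1" "a \<ge> 0"
  shows "geodesic_segment hyp_plane hyp_dist (hyp_polar u v 0) (hyp_polar u v a) (hyp_polar u v ` {0..a})"
  unfolding geodesic_segment_def
  using hyp_dist_polar_same[OF assms(1)] hyp_polar_in_hyp_plane[OF assms(1)] assms(2)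
  by (intro exI[of _ "hyp_polar u v"]) auto

lemma CAT_minus_one_geodesic:
  fixes x y :: "'a::metric_space"
  assumes "CAT_minus_one (UNIV :: 'a set) dist"
  obtains c where "isometric_path (dist x y) c" "c 0 = x" "c (dist x y) = y"
proof -
  obtain S where "geodesic_segment UNIV dist x y S"
    using assms unfolding CAT_minus_one_def by blast
  then show thesis using that unfolding geodesic_segment_def isometric_path_def by blast
qed

text \<open>In the hyperbolic plane this is an equality, the hyperbolic form of Stewart's theorem: the law of
  cosines at the vertex \<open>c 0\<close> with the angle eliminated. The comparison triangle is therefore placed with
  that vertex at the centre of polar coordinates, where two sides are radial and the third one enters only
  through the cosine \<open>k\<close> of the angle. All coefficients on the right are nonnegative, so that two
  applications of the inequality can be chained without loss; no further comparison figure is needed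
  anywhere below.\<close>

lemma Stewart_inequality:
  fixes z :: "'a::metric_space"
  assumes CAT: "CAT_minus_one (UNIV :: 'a set) dist"
    and c: "isometric_path a c" and t: "0 \<le> t" "t \<le> a"
  shows "cosh (dist z (c t)) * sinh a \<le> sinh (a - t) * cosh (dist z (c 0)) + sinh t * cosh (dist z (c a))"
proof -
  define b e where "b = dist z (c 0)" and "e = dist z (c a)"
  have dc: "dist (c s) (c t) = \<bar>s - t\<bar>" if "s \<in> {0..a}" "t \<in> {0..a}" for s t
    using c that by (simp add: isometric_path_def)
  have da: "dist (c 0) (c a) = a" using dc[of 0 a] t by simp
  have dt: "dist (c 0) (c t) = t" using dc[of 0 t] t by simp
  consider "a = 0" | "b = 0" | "a > 0" "b > 0"
    using t by (fastforce simp: b_def)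
  then show ?thesis
  proof cases
    case 1 then show ?thesis using t by simp
  next
    case 2
    then have "z = c 0" by (simp add: b_def)
    then show ?thesis using da dt
      by (simp add: sinh_diff algebra_simps)
  next
    case 3
    define k where "k = (cosh a * cosh b - cosh e) / (sinh a * sinh b)"
    have pos: "sinh a * sinh b > 0" using 3 by simp
    have cose: "cosh e = cosh a * cosh b - sinh a * sinh b * k"
      using 3 by (simp add: k_def)
    \<comment> \<open>The two triangle inequalities say exactly that \<open>k\<close> is the cosine of an angle.\<close>
    have "e \<le> a + b" using dist_triangle[of z "c a" "c 0"] da by (simp add: e_def b_def)
    then have "cosh e \<le> cosh (a + b)" by (subst cosh_real_nonneg_le_iff) (use 3 in \<open>auto simp: e_def\<close>)
    then have "- (sinh a * sinh b) \<le> sinh a * sinh b * k" by (simp add: cose cosh_add)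
    then have k1: "- 1 \<le> k"
      using pos by (metis mult_minus1_right mult_le_cancel_left_pos)
    have "\<bar>a - b\<bar> \<le> e" using dist_triangle[of z "c 0" "c a"] dist_triangle[of "c 0" "c a" z] da
      by (auto simp: e_def b_def dist_commute)
    then have "cosh \<bar>a - b\<bar> \<le> cosh e" by (subst cosh_real_nonneg_le_iff) (auto simp: e_def)
    then have "sinh a * sinh b * k \<le> sinh a * sinh b * 1" by (simp add: cose cosh_diff)
    then have k2: "k \<le> 1"
      using pos by (metis mult_le_cancel_left_pos)
    \<comment> \<open>\<open>(k, l)\<close> is the direction of the side from \<open>c 0\<close> to \<open>z\<close>.\<close>
    define l where "l = sqrt (1 - k\<^sup>2)"
    have "k\<^sup>2 \<le> 1" using k1 k2 by (simp add: abs_square_le_1 abs_le_iff)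
    then have kl: "k\<^sup>2 + l\<^sup>2 = 1" by (simp add: l_def)
    obtain c' where c': "isometric_path b c'" "c' 0 = c 0" "c' b = z"
      using CAT_minus_one_geodesic[OF CAT, of "c 0" z] by (metis b_def dist_commute)
    have hz: "hyp_polar u v 0 = hyp_polar 1 0 0" for u v by (simp add: hyp_polar_def)
    have "dist (c t) z \<le> hyp_dist (hyp_polar 1 0 t) (hyp_polar k l b)"
    proof -
      note C = CAT[unfolded CAT_minus_one_def, THEN conjunct2, rule_format, OF UNIV_I UNIV_I UNIV_I,
          of "c 0" "c a" "c ` {0..a}" z "c' ` {0..b}"
             "hyp_polar 1 0 0" "hyp_polar 1 0 a" "hyp_polar k l b"
             "hyp_polar 1 0 ` {0..a}" "hyp_polar k l ` {0..b}" "c t" z "hyp_polar 1 0 t" "hyp_polar k l b"]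
      show ?thesis
      proof (rule C)
        show "geodesic_segment UNIV dist (c 0) (c a) (c ` {0..a})"
          unfolding geodesic_segment_def da using dc by (intro exI[of _ c]) auto
        have "dist (c 0) z = b" by (simp add: b_def dist_commute)
        then show "geodesic_segment UNIV dist (c 0) z (c' ` {0..b})"
          unfolding geodesic_segment_def using c' by (intro exI[of _ c']) (auto simp: isometric_path_def)
        show "hyp_dist (hyp_polar 1 0 0) (hyp_polar 1 0 a) = dist (c 0) (c a)"
          using hyp_dist_polar_same[of 1 0 0 a] 3 da by simp
        show "hyp_dist (hyp_polar 1 0 a) (hyp_polar k l b) = dist (c a) z"
          using arcosh_cosh_real[of e] by (simp add: hyp_dist_polar flip: cose)
            (simp add: e_def dist_commute)
        show *: "hyp_dist (hyp_polar 1 0 0) (hyp_polar k l b) = dist (c 0) z"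
          using hyp_dist_polar_same[of k l 0 b] 3 kl hz[of k l] \<open>dist (c 0) z = b\<close> by simp
        show "hyp_dist (hyp_polar 1 0 0) (hyp_polar k l b) = dist (c 0) z" by (rule *)
        show "geodesic_segment hyp_plane hyp_dist (hyp_polar 1 0 0) (hyp_polar 1 0 a) (hyp_polar 1 0 ` {0..a})"
          using 3 by (intro geodesic_segment_hyp_polar) auto
        show "geodesic_segment hyp_plane hyp_dist (hyp_polar 1 0 0) (hyp_polar k l b) (hyp_polar k l ` {0..b})"
          using geodesic_segment_hyp_polar[OF kl, of b] 3 hz[of k l] by simp
        show "hyp_dist (hyp_polar 1 0 0) (hyp_polar 1 0 t) = dist (c 0) (c t)"
          using hyp_dist_polar_same[of 1 0 0 t] t dt by simp
        show "z \<in> c' ` {0..b}" using c' 3 by (metis atLeastAtMost_iff imageI less_imp_le order_refl)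
      qed (use t 3 kl in \<open>auto intro!: hyp_polar_in_hyp_plane\<close>)
    qed
    also have "\<dots> = arcosh (cosh t * cosh b - sinh t * sinh b * k)"
      by (simp add: hyp_dist_polar)
    finally have le: "dist z (c t) \<le> arcosh (cosh t * cosh b - sinh t * sinh b * k)"
      by (simp add: dist_commute)
    have "sinh t * sinh b * k \<le> sinh t * sinh b * 1"
      using t 3 k2 by (intro mult_left_mono) auto
    then have "cosh (t - b) \<le> cosh t * cosh b - sinh t * sinh b * k"
      by (simp add: cosh_diff)
    then have ge1: "1 \<le> cosh t * cosh b - sinh t * sinh b * k"
      using cosh_real_ge_1 order_trans by blast
    have "cosh (dist z (c t)) \<le> cosh (arcosh (cosh t * cosh b - sinh t * sinh b * k))"
      using le by (subst cosh_real_nonneg_le_iff) (auto intro: order_trans[OF zero_le_dist])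
    also have "\<dots> = cosh t * cosh b - sinh t * sinh b * k" using ge1 by simp
    finally have "cosh (dist z (c t)) * sinh a \<le> (cosh t * cosh b - sinh t * sinh b * k) * sinh a"
      using 3 by (intro mult_right_mono) auto
    also have "\<dots> = sinh (a - t) * cosh b + sinh t * cosh e"
      by (simp add: cose sinh_diff algebra_simps)
    finally show ?thesis by (simp add: b_def e_def)
  qed
qed


section \<open>Convexity of the distance function\<close>

lemma isometric_path_subset: "isometric_path a c \<Longrightarrow> b \<le> a \<Longrightarrow> isometric_path b c"
  by (auto simp: isometric_path_def)

lemma isometric_path_ray: "geodesic_ray c \<Longrightarrow> isometric_path a c"
  by (auto simp: isometric_path_def geodesic_ray_def)

lemma isometric_path_dist_start: "isometric_path a c \<Longrightarrow> 0 \<le> t \<Longrightarrow> t \<le> a \<Longrightarrow> dist (c 0) (c t) = t"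
  by (auto simp: isometric_path_def)

lemma isometric_path_dist_end: "isometric_path a c \<Longrightarrow> 0 \<le> t \<Longrightarrow> t \<le> a \<Longrightarrow> dist (c t) (c a) = a - t"
  by (auto simp: isometric_path_def)

lemma geodesic_ray_dist: "geodesic_ray c \<Longrightarrow> 0 \<le> s \<Longrightarrow> 0 \<le> t \<Longrightarrow> dist (c s) (c t) = \<bar>s - t\<bar>"
  by (auto simp: geodesic_ray_def)


text \<open>Up to additive constants this says that the distance to the midpoint of a segment of length \<open>a\<close> is
  smaller than the larger distance to its endpoints by \<open>a / 2\<close>. This quantitative convexity, which
  fails in flat space, is what keeps sublevel sets bounded in the sequel.\<close>

lemma midpoint_contraction:
  fixes z :: "'a::metric_space"
  assumes CAT: "CAT_minus_one (UNIV :: 'a set) dist" and c: "isometric_path a c" and a: "0 \<le> a"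
  shows "cosh (dist z (c (a / 2))) * cosh (a / 2) \<le> cosh (max (dist z (c 0)) (dist z (c a)))"
proof (cases "a = 0")
  case True then show ?thesis by simp
next
  case False
  let ?M = "max (dist z (c 0)) (dist z (c a))"
  have pos: "sinh (a / 2) > 0" using False a by simp
  have sa: "sinh a = 2 * sinh (a / 2) * cosh (a / 2)" using sinh_double[of "a / 2"] by simp
  have "sinh (a / 2) * (2 * (cosh (dist z (c (a / 2))) * cosh (a / 2)))
      \<le> sinh (a / 2) * (cosh (dist z (c 0)) + cosh (dist z (c a)))"
    using Stewart_inequality[OF CAT c, of "a / 2" z] a by (simp add: sa algebra_simps)
  then have "2 * (cosh (dist z (c (a / 2))) * cosh (a / 2)) \<le> cosh (dist z (c 0)) + cosh (dist z (c a))"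
    using pos mult_le_cancel_left_pos by blast
  also have "\<dots> \<le> cosh ?M + cosh ?M"
    by (intro add_mono) (auto simp: cosh_real_nonneg_le_iff le_max_iff_disj)
  finally show ?thesis by simp
qed

lemma dist_quasi_convex:
  fixes z :: "'a::metric_space"
  assumes CAT: "CAT_minus_one (UNIV :: 'a set) dist" and c: "isometric_path a c"
    and t: "0 \<le> t" "t \<le> a"
  shows "dist z (c t) \<le> max (dist z (c 0)) (dist z (c a))"
proof (cases "a = 0")
  case True then show ?thesis using t by simp
next
  case False
  let ?M = "max (dist z (c 0)) (dist z (c a))"
  have a: "a > 0" using False t by simp
  have "sinh a = sinh (a - t) * cosh t + cosh (a - t) * sinh t"
    using sinh_add[of "a - t" t] by simp
  moreover have "sinh (a - t) * 1 \<le> sinh (a - t) * cosh t" "1 * sinh t \<le> cosh (a - t) * sinh t"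
    using t by (intro mult_left_mono mult_right_mono cosh_real_ge_1; simp)+
  ultimately have "sinh (a - t) + sinh t \<le> sinh a" by linarith
  have "cosh (dist z (c t)) * sinh a \<le> sinh (a - t) * cosh (dist z (c 0)) + sinh t * cosh (dist z (c a))"
    by (rule Stewart_inequality[OF CAT c t])
  also have "\<dots> \<le> sinh (a - t) * cosh ?M + sinh t * cosh ?M"
    using t by (intro add_mono mult_left_mono) (auto simp: cosh_real_nonneg_le_iff le_max_iff_disj)
  also have "\<dots> = (sinh (a - t) + sinh t) * cosh ?M" by (simp add: algebra_simps)
  also have "\<dots> \<le> sinh a * cosh ?M"
    using \<open>sinh (a - t) + sinh t \<le> sinh a\<close> by (intro mult_right_mono) auto
  finally have "cosh (dist z (c t)) \<le> cosh ?M" using a by (simp add: mult.commute)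
  then show ?thesis by (subst (asm) cosh_real_nonneg_le_iff) (auto simp: le_max_iff_disj)
qed

text \<open>Two geodesics issuing from the same point: Stewart's inequality moves first one endpoint and then
  the other one down to parameter \<open>t\<close>. In the hyperbolic plane both sides are equal, since each is
  twice the squared sine of half the angle multiplied by \<open>sinh\<^sup>2 s * sinh\<^sup>2 t\<close>.\<close>

lemma isosceles_comparison:
  fixes c c' :: "real \<Rightarrow> 'a::metric_space"
  assumes CAT: "CAT_minus_one (UNIV :: 'a set) dist"
    and c: "isometric_path s c" and c': "isometric_path s c'" and eq: "c 0 = c' 0"
    and t: "0 \<le> t" "t \<le> s"
  shows "(cosh (dist (c t) (c' t)) - 1) * (sinh s)\<^sup>2 \<le> (sinh t)\<^sup>2 * (cosh (dist (c s) (c' s)) - 1)"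
proof -
  define d D e where "d = dist (c t) (c' t)" and "D = dist (c s) (c' s)" and "e = dist (c t) (c' s)"
  have "dist (c 0) (c' s) = s" "dist (c t) (c' 0) = t"
    using isometric_path_dist_start[OF c', of s] isometric_path_dist_start[OF c, of t] eq t
    by (simp_all add: dist_commute)
  note this [simp]
  have 1: "cosh e * sinh s \<le> sinh (s - t) * cosh s + sinh t * cosh D"
    using Stewart_inequality[OF CAT c t, of "c' s"] by (simp add: e_def D_def dist_commute)
  have "cosh d * sinh s \<le> sinh (s - t) * cosh t + sinh t * cosh e"
    using Stewart_inequality[OF CAT c' t, of "c t"] by (simp add: e_def d_def)
  then have "(cosh d * sinh s) * sinh s \<le> (sinh (s - t) * cosh t + sinh t * cosh e) * sinh s"
    using t by (intro mult_right_mono) auto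
  also have "\<dots> = sinh (s - t) * cosh t * sinh s + sinh t * (cosh e * sinh s)"
    by (simp add: algebra_simps)
  also have "\<dots> \<le> sinh (s - t) * cosh t * sinh s + sinh t * (sinh (s - t) * cosh s + sinh t * cosh D)"
    using 1 t by (intro add_left_mono mult_left_mono) auto
  also have "\<dots> = sinh (s - t) * (cosh t * sinh s + sinh t * cosh s) + (sinh t)\<^sup>2 * cosh D"
    by (simp add: algebra_simps power2_eq_square)
  also have "sinh (s - t) * (cosh t * sinh s + sinh t * cosh s) = (sinh s)\<^sup>2 * (cosh t)\<^sup>2 - (cosh s)\<^sup>2 * (sinh t)\<^sup>2"
    by (simp add: sinh_diff power2_eq_square algebra_simps)
  also have "\<dots> = (sinh s)\<^sup>2 - (sinh t)\<^sup>2" by (simp add: cosh_square_eq algebra_simps)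
  finally show ?thesis by (simp add: d_def D_def algebra_simps power2_eq_square)
qed

lemma dist_mono_common_start:
  fixes c c' :: "real \<Rightarrow> 'a::metric_space"
  assumes CAT: "CAT_minus_one (UNIV :: 'a set) dist"
    and c: "isometric_path s c" and c': "isometric_path s c'" and eq: "c 0 = c' 0"
    and t: "0 \<le> t" "t \<le> s"
  shows "dist (c t) (c' t) \<le> dist (c s) (c' s)"
proof (cases "s = 0")
  case True then show ?thesis using t by simp
next
  case False
  then have s: "sinh s > 0" using t by simp
  have D: "cosh (dist (c s) (c' s)) - 1 \<ge> 0" using cosh_real_ge_1[of "dist (c s) (c' s)"] by simp
  have "(cosh (dist (c t) (c' t)) - 1) * (sinh s)\<^sup>2 \<le> (sinh t)\<^sup>2 * (cosh (dist (c s) (c' s)) - 1)"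
    by (rule isosceles_comparison[OF assms])
  also have "\<dots> \<le> (sinh s)\<^sup>2 * (cosh (dist (c s) (c' s)) - 1)"
    using t D by (intro mult_right_mono power_mono) auto
  finally have "cosh (dist (c t) (c' t)) \<le> cosh (dist (c s) (c' s))" using s by (simp add: mult.commute)
  then show ?thesis by (subst (asm) cosh_real_nonneg_le_iff) auto
qed

section \<open>Limits of geodesics\<close>

lemma compact_pointwise_box:
  fixes S :: "'i \<Rightarrow> 'b::topological_space set"
  assumes "\<And>i. compact (S i)"
  shows "compact {f. \<forall>i. f i \<in> S i}"
proof -
  have "compactin (product_topology (\<lambda>i. euclidean) UNIV) (PiE UNIV S)"
    using assms by (simp add: compactin_PiE)
  moreover have "PiE UNIV S = {f. \<forall>i. f i \<in> S i}" by (auto simp: PiE_def)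
  ultimately show ?thesis by (simp add: euclidean_product_topology)
qed

text \<open>The points at each integer parameter stay in a ball, so a diagonal sequence converges there; it is
  obtained here from compactness of a countable product of balls. Geodesics from a common point are
  farthest apart at their ends, so convergence at one parameter forces it at all smaller ones.\<close>

lemma geodesics_subconverge_to_ray:
  fixes c :: "nat \<Rightarrow> real \<Rightarrow> 'a::heine_borel"
  assumes CAT: "CAT_minus_one (UNIV :: 'a set) dist"
    and c: "\<And>n. isometric_path (L n) (c n)" and start: "\<And>n. c n 0 = p"
    and L: "filterlim L at_top sequentially"
  obtains r b where "strict_mono (r :: nat \<Rightarrow> nat)" "geodesic_ray b" "b 0 = p"
    "\<And>t. 0 \<le> t \<Longrightarrow> (\<lambda>n. c (r n) t) \<longlonglongrightarrow> b t"
proof -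
  define f where "f n k = (if real k \<le> L n then c n (real k) else p)" for n k
  have "f n k \<in> cball p (real k)" for n k
    using isometric_path_dist_start[OF c, of "real k" n] by (auto simp: f_def start)
  then have "\<forall>n. f n \<in> {g. \<forall>k. g k \<in> cball p (real k)}" by blast
  moreover have "seq_compact {g. \<forall>k. g k \<in> cball p (real k)}"
    by (intro compact_imp_seq_compact compact_pointwise_box compact_cball)
  ultimately obtain g r where r: "strict_mono (r :: nat \<Rightarrow> nat)" and g: "(f \<circ> r) \<longlonglongrightarrow> g"
    unfolding seq_compact_def by meson
  have fk: "(\<lambda>n. f (r n) k) \<longlonglongrightarrow> g k" for k
    using continuous_on_tendsto_compose[OF continuous_on_product_coordinates g, of k] by (simp add: o_def)
  have Lr: "\<forall>\<^sub>F n in sequentially. T \<le> L (r n)" for T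
    using filterlim_compose[OF L filterlim_subseq[OF r]] by (simp add: filterlim_at_top)
  have conv: "convergent (\<lambda>n. c (r n) t)" if t: "0 \<le> t" for t
  proof -
    obtain k where k: "t \<le> real k" using real_arch_simple by blast
    have "Cauchy (\<lambda>n. f (r n) k)" using fk LIMSEQ_imp_Cauchy by blast
    have "Cauchy (\<lambda>n. c (r n) t)"
    proof (rule metric_CauchyI)
      fix e :: real assume "e > 0"
      then obtain M where M: "\<And>m n. M \<le> m \<Longrightarrow> M \<le> n \<Longrightarrow> dist (f (r m) k) (f (r n) k) < e"
        using metric_CauchyD[OF \<open>Cauchy (\<lambda>n. f (r n) k)\<close>] by blast
      obtain N where N: "\<And>n. N \<le> n \<Longrightarrow> real k \<le> L (r n)"
        using Lr[of "real k"] by (auto simp: eventually_sequentially)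
      have "dist (c (r m) t) (c (r n) t) < e" if "max M N \<le> m" "max M N \<le> n" for m n
      proof -
        have "dist (c (r m) t) (c (r n) t) \<le> dist (c (r m) (real k)) (c (r n) (real k))"
          using N[of m] N[of n] that t k
          by (intro dist_mono_common_start[OF CAT]) (auto simp: start intro: isometric_path_subset[OF c])
        also have "\<dots> < e" using M[of m n] N[of m] N[of n] that by (simp add: f_def)
        finally show ?thesis .
      qed
      then show "\<exists>M. \<forall>m\<ge>M. \<forall>n\<ge>M. dist (c (r m) t) (c (r n) t) < e" by blast
    qed
    then show ?thesis by (rule Cauchy_convergent)
  qed
  define b where "b = restrict (\<lambda>t. lim (\<lambda>n. c (r n) t)) {0..}"
  have b: "(\<lambda>n. c (r n) t) \<longlonglongrightarrow> b t" if "0 \<le> t" for t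
    using conv[OF that] that by (simp add: b_def convergent_LIMSEQ_iff)
  have "geodesic_ray b"
    unfolding geodesic_ray_def
  proof (intro conjI allI impI)
    show "b \<in> extensional {0..}" by (simp add: b_def)
    fix s t :: real assume st: "0 \<le> s" "0 \<le> t"
    have "(\<lambda>n. dist (c (r n) s) (c (r n) t)) \<longlonglongrightarrow> dist (b s) (b t)"
      by (intro tendsto_dist b st)
    moreover have "(\<lambda>n. dist (c (r n) s) (c (r n) t)) \<longlonglongrightarrow> \<bar>s - t\<bar>"
    proof (rule tendsto_eventually)
      show "\<forall>\<^sub>F n in sequentially. dist (c (r n) s) (c (r n) t) = \<bar>s - t\<bar>"
        using Lr[of "max s t"]
        by eventually_elim (use st c in \<open>auto simp: isometric_path_def\<close>)
    qed
    ultimately show "dist (b s) (b t) = \<bar>s - t\<bar>" by (rule LIMSEQ_unique)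
  qed
  moreover have "b 0 = p" using b[of 0] by (simp add: start LIMSEQ_const_iff)
  ultimately show thesis using that r b by blast
qed

text \<open>The upper bound only uses the triangle inequality. For the lower bound, suppose that the left-hand
  side were at most \<open>a < ray_busemann b w\<close>. In Stewart's inequality for \<open>c n t\<close> on the geodesic from
  \<open>p\<close> to \<open>c n (L n)\<close>, seen from \<open>w\<close>, the limit \<open>n \<rightarrow> \<infinity>\<close> gives
  \<open>cosh (dist w (b t)) \<le> exp (- t) * cosh (dist w p) + sinh t * exp a\<close>. For large \<open>t\<close> the left side is
  about \<open>exp (t + ray_busemann b w) / 2\<close> and the right side about \<open>exp (t + a) / 2\<close>, which is absurd.\<close>

lemma dist_tendsto_ray_busemann:
  fixes c :: "nat \<Rightarrow> real \<Rightarrow> 'a::metric_space"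
  assumes CAT: "CAT_minus_one (UNIV :: 'a set) dist"
    and c: "\<And>n. isometric_path (L n) (c n)" and start: "\<And>n. c n 0 = p"
    and L: "filterlim L at_top sequentially"
    and b: "geodesic_ray b" and lim: "\<And>t. 0 \<le> t \<Longrightarrow> (\<lambda>n. c n t) \<longlonglongrightarrow> b t"
  shows "(\<lambda>n. dist w (c n (L n)) - L n) \<longlonglongrightarrow> ray_busemann b w"
proof (rule order_tendstoI)
  have Lge: "\<forall>\<^sub>F n in sequentially. T \<le> L n" for T
    using L by (simp add: filterlim_at_top)
  note B = ray_busemann_tendsto[OF b, of w]
  {
    fix a assume "ray_busemann b w < a"
    then have "\<forall>\<^sub>F t in at_top. dist w (b t) - t < a" using B order_tendstoD(2) by blast
    then obtain t where t: "0 \<le> t" "dist w (b t) - t < a"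
      using eventually_happens'[OF trivial_limit_at_top_linorder, OF eventually_conj[OF eventually_ge_at_top[of 0]]]
      by blast
    have "(\<lambda>n. dist w (c n t) - t) \<longlonglongrightarrow> dist w (b t) - t"
      by (intro tendsto_intros lim t)
    then have "\<forall>\<^sub>F n in sequentially. dist w (c n t) - t < a" using t(2) order_tendstoD(2) by blast
    then show "\<forall>\<^sub>F n in sequentially. dist w (c n (L n)) - L n < a"
      using Lge[of t]
    proof eventually_elim
      case (elim n)
      have "dist w (c n (L n)) \<le> dist w (c n t) + dist (c n t) (c n (L n))" by (rule dist_triangle)
      also have "dist (c n t) (c n (L n)) = L n - t"
        using isometric_path_dist_end[OF c] elim t by auto
      finally show ?case using elim by simp
    qed
  }
  fix a assume a: "a < ray_busemann b w"
  define D where "D = dist w p"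
  \<comment> \<open>The contradicting parameter \<open>t\<close>; the expression is the gap in that inequality times \<open>exp (- t)\<close>.\<close>
  have "((\<lambda>t. exp (dist w (b t) - t) / 2 + exp (- dist w (b t)) * exp (- t) / 2
           - (exp (- t) * (exp (- t) * cosh D) + exp (- t) * sinh t * exp a))
         \<longlongrightarrow> exp (ray_busemann b w) / 2 + 0 - (0 + exp a / 2)) at_top"
  proof (intro tendsto_intros B)
    have e0: "((\<lambda>t::real. exp (- t)) \<longlongrightarrow> 0) at_top" by real_asymp
    show "((\<lambda>t. exp (- dist w (b t)) * exp (- t) / 2) \<longlongrightarrow> 0) at_top"
      by (rule Lim_null_comparison[OF _ e0]) (auto intro!: always_eventually mult_le_one order_trans[OF _ one_le_numeral])
    show "((\<lambda>t. exp (- t) * (exp (- t) * cosh D)) \<longlongrightarrow> 0) at_top" by real_asymp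
    have "((\<lambda>t::real. exp (- t) * sinh t) \<longlongrightarrow> 1 / 2) at_top"
      unfolding sinh_field_def by real_asymp
    from tendsto_mult_right[OF this, of "exp a"]
    show "((\<lambda>t. exp (- t) * sinh t * exp a) \<longlongrightarrow> exp a / 2) at_top" by simp
  qed simp_all
  moreover have "exp (ray_busemann b w) / 2 + 0 - (0 + exp a / 2) > 0" using a by simp
  ultimately have "\<forall>\<^sub>F t in at_top. exp (dist w (b t) - t) / 2 + exp (- dist w (b t)) * exp (- t) / 2
           - (exp (- t) * (exp (- t) * cosh D) + exp (- t) * sinh t * exp a) > 0"
    using order_tendstoD(1) by blast
  then obtain t where t: "0 < t" and "exp (dist w (b t) - t) / 2 + exp (- dist w (b t)) * exp (- t) / 2
           - (exp (- t) * (exp (- t) * cosh D) + exp (- t) * sinh t * exp a) > 0"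
    using eventually_happens'[OF trivial_limit_at_top_linorder, OF eventually_conj[OF eventually_gt_at_top[of 0]]]
    by blast
  moreover have "exp (dist w (b t) - t) / 2 + exp (- dist w (b t)) * exp (- t) / 2
           - (exp (- t) * (exp (- t) * cosh D) + exp (- t) * sinh t * exp a)
       = exp (- t) * (cosh (dist w (b t)) - (exp (- t) * cosh D + sinh t * exp a))"
    by (simp add: cosh_def exp_diff exp_minus field_simps)
  ultimately have gap: "exp (- t) * cosh D + sinh t * exp a < cosh (dist w (b t))"
    by (simp add: zero_less_mult_iff)
  have l1: "(\<lambda>n. sinh (L n - t) / sinh (L n)) \<longlonglongrightarrow> exp (- t)"
  proof (rule filterlim_compose[OF _ L])
    show "((\<lambda>l. sinh (l - t) / sinh l) \<longlongrightarrow> exp (- t)) at_top"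
      unfolding sinh_field_def by (real_asymp simp: exp_minus inverse_eq_divide)
  qed
  have l2: "(\<lambda>n. cosh (L n + a) / sinh (L n)) \<longlonglongrightarrow> exp a"
  proof (rule filterlim_compose[OF _ L])
    show "((\<lambda>l. cosh (l + a) / sinh l) \<longlongrightarrow> exp a) at_top"
      unfolding sinh_field_def cosh_field_def by (real_asymp simp: exp_minus inverse_eq_divide)
  qed
  have "(\<lambda>n. cosh (dist w (c n t)) - (sinh (L n - t) / sinh (L n) * cosh D + sinh t * (cosh (L n + a) / sinh (L n))))
      \<longlonglongrightarrow> cosh (dist w (b t)) - (exp (- t) * cosh D + sinh t * exp a)"
    using t by (intro tendsto_intros l1 l2 lim) auto
  then have "\<forall>\<^sub>F n in sequentially. 0 < cosh (dist w (c n t)) -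
      (sinh (L n - t) / sinh (L n) * cosh D + sinh t * (cosh (L n + a) / sinh (L n)))"
    by (rule order_tendstoD(1)) (use gap in simp)
  then show "\<forall>\<^sub>F n in sequentially. a < dist w (c n (L n)) - L n"
    using Lge[of t] 
  proof eventually_elim
    case (elim n)
    have sL: "sinh (L n) > 0" using elim t by simp
    have "(sinh (L n - t) / sinh (L n) * cosh D + sinh t * (cosh (L n + a) / sinh (L n))) * sinh (L n)
        < cosh (dist w (c n t)) * sinh (L n)"
      using elim sL by (intro mult_strict_right_mono) auto
    also have "\<dots> \<le> sinh (L n - t) * cosh D + sinh t * cosh (dist w (c n (L n)))"
      using Stewart_inequality[OF CAT c, of t n w] elim t by (simp add: start D_def)
    finally have "sinh t * cosh (L n + a) < sinh t * cosh (dist w (c n (L n)))"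
      using sL by (simp add: field_simps)
    then have "cosh (L n + a) < cosh (dist w (c n (L n)))" using t by simp
    then have "cosh \<bar>L n + a\<bar> < cosh (dist w (c n (L n)))" by simp
    then have "\<bar>L n + a\<bar> < dist w (c n (L n))"
      by (subst (asm) cosh_real_nonneg_less_iff) auto
    then show ?case by simp
  qed
qed


section \<open>Asymptotic and diverging rays\<close>

text \<open>In the isosceles comparison the distance at parameter \<open>s\<close> stays bounded while \<open>(sinh s)\<^sup>2\<close> tends to
  infinity, so the distance at every \<open>t\<close> vanishes.\<close>

lemma ray_unique:
  fixes b c :: "real \<Rightarrow> 'a::metric_space"
  assumes CAT: "CAT_minus_one (UNIV :: 'a set) dist"
    and bc: "(b, c) \<in> asymptotic_rays" and start: "b 0 = c 0"
  shows "b = c"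
proof
  have b: "geodesic_ray b" and c: "geodesic_ray c" using bc by (auto simp: asymptotic_rays_def)
  obtain B where B: "\<And>t. 0 \<le> t \<Longrightarrow> dist (b t) (c t) \<le> B" using bc by (auto simp: asymptotic_rays_def)
  fix t
  show "b t = c t"
  proof (cases "0 \<le> t")
    case False
    then show ?thesis using b c by (simp add: geodesic_ray_def extensional_def)
  next
    case True
    let ?k = "cosh (dist (b t) (c t)) - 1"
    have "?k * (sinh s)\<^sup>2 \<le> (sinh t)\<^sup>2 * (cosh B - 1)" if "t \<le> s" for s
    proof -
      have "?k * (sinh s)\<^sup>2 \<le> (sinh t)\<^sup>2 * (cosh (dist (b s) (c s)) - 1)"
        using that True b c start by (intro isosceles_comparison[OF CAT]) (auto intro: isometric_path_ray)
      also have "\<dots> \<le> (sinh t)\<^sup>2 * (cosh B - 1)"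
        using B[of s] that True order_trans[OF zero_le_dist B[of s]]
        by (intro mult_left_mono diff_right_mono) (auto simp: cosh_real_nonneg_le_iff)
      finally show ?thesis .
    qed
    then have "?k \<le> (sinh t)\<^sup>2 * (cosh B - 1) / (sinh s)\<^sup>2" if "max t 1 \<le> s" for s
      using that by (subst pos_le_divide_eq) auto
    then have "\<forall>\<^sub>F s in at_top. ?k \<le> (sinh t)\<^sup>2 * (cosh B - 1) / (sinh s)\<^sup>2"
      using eventually_ge_at_top[of "max t 1"] by (auto elim: eventually_mono)
    moreover have "((\<lambda>s. (sinh t)\<^sup>2 * (cosh B - 1) / (sinh s)\<^sup>2) \<longlongrightarrow> 0) at_top"
      unfolding sinh_field_def[of s for s] by real_asymp
    ultimately have "?k \<le> 0"
      using tendsto_lowerbound trivial_limit_at_top_linorder by blast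
    then have "cosh (dist (b t) (c t)) = 1" using cosh_real_ge_1[of "dist (b t) (c t)"] by simp
    then show ?thesis by simp
  qed
qed

text \<open>The ray is a limit of geodesics from \<open>p\<close> to the points \<open>c n\<close>. Stewart's inequality on such a
  geodesic, seen from \<open>c t\<close>, bounds \<open>cosh\<close> of the distance at parameter \<open>t\<close> by \<open>exp (dist p (c 0))\<close>
  independently of \<open>t\<close> and \<open>n\<close>.\<close>

lemma ray_from_point:
  fixes c :: "real \<Rightarrow> 'a::heine_borel"
  assumes CAT: "CAT_minus_one (UNIV :: 'a set) dist" and c: "geodesic_ray c"
  obtains b where "(c, b) \<in> asymptotic_rays" "b 0 = p"
proof -
  define L where "L n = dist p (c (real n))" for n
  define D where "D = dist p (c 0)"
  have Lge: "real n - D \<le> L n" for n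
    using dist_triangle[of "c 0" "c (real n)" p] geodesic_ray_dist[OF c, of 0 "real n"]
    by (simp add: L_def D_def dist_commute)
  have L: "filterlim L at_top sequentially"
    by (rule filterlim_at_top_mono[of "\<lambda>n. real n - D"]) (use Lge in \<open>auto intro: always_eventually\<close>, real_asymp)
  have "\<exists>g. isometric_path (L n) g \<and> g 0 = p \<and> g (L n) = c (real n)" for n
    using CAT_minus_one_geodesic[OF CAT, of p "c (real n)"] unfolding L_def by metis
  then obtain g where g: "\<And>n. isometric_path (L n) (g n)" "\<And>n. g n 0 = p" "\<And>n. g n (L n) = c (real n)"
    by metis
  obtain r b where r: "strict_mono (r :: nat \<Rightarrow> nat)" and b: "geodesic_ray b" "b 0 = p"
    and lim: "\<And>t. 0 \<le> t \<Longrightarrow> (\<lambda>n. g (r n) t) \<longlonglongrightarrow> b t"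
    using geodesics_subconverge_to_ray[OF CAT g(1,2) L] by blast
  have Lr: "filterlim (\<lambda>n. L (r n)) at_top sequentially"
    using filterlim_compose[OF L filterlim_subseq[OF r]] .
  define M where "M = exp D"
  have bound: "cosh (dist (c t) (b t)) \<le> M" if t: "0 \<le> t" for t
  proof -
    have "\<forall>\<^sub>F n in sequentially. max t 1 \<le> L (r n)" "\<forall>\<^sub>F n in sequentially. t + D + 1 \<le> real (r n)"
      using Lr filterlim_compose[OF filterlim_real_sequentially filterlim_subseq[OF r]]
      unfolding filterlim_at_top by blast+
    then have "\<forall>\<^sub>F n in sequentially. cosh (dist (c t) (g (r n) t)) \<le> M"
    proof eventually_elim
      case (elim n)
      define l where "l = L (r n)"
      define m where "m = real (r n)"
      have l: "max t 1 \<le> l" "m - D \<le> l" "t + D + 1 \<le> m" "D \<ge> 0"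
        using elim Lge[of "r n"] by (auto simp: l_def m_def D_def)
      then have sl: "sinh l > 0" by simp
      have dp: "dist (c t) p \<le> t + D"
        using dist_triangle[of "c t" p "c 0"] geodesic_ray_dist[OF c, of t 0] t by (simp add: D_def dist_commute)
      have dm: "dist (c t) (g (r n) l) = m - t"
        using g(3)[of "r n"] geodesic_ray_dist[OF c, of t m] t l by (simp add: l_def m_def)
      have "cosh (dist (c t) (g (r n) t)) * sinh l \<le> sinh (l - t) * cosh (dist (c t) p) + sinh t * cosh (m - t)"
        using Stewart_inequality[OF CAT g(1), of t "r n" "c t"] l t dm by (simp add: g(2) l_def)
      also have "\<dots> \<le> sinh (l - t) * cosh (t + D) + sinh t * cosh (l + D - t)"
        using l t dp by (intro add_mono mult_left_mono) (auto simp: cosh_real_nonneg_le_iff)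
      also have "\<dots> \<le> sinh l * M"
      proof -
        have "sinh (l - t) * cosh (t + D) + sinh t * cosh (l + D - t) =
           sinh l * cosh D + sinh D * (sinh (l - t) * sinh t + sinh t * sinh (l - t))"
        proof -
          have 1: "cosh (t + D) = cosh t * cosh D + sinh t * sinh D" by (rule cosh_add)
          have 2: "cosh (l + D - t) = cosh (l - t) * cosh D + sinh (l - t) * sinh D"
            using cosh_add[of "l - t" D] by (simp add: algebra_simps)
          have 3: "sinh l = sinh (l - t) * cosh t + cosh (l - t) * sinh t"
            using sinh_add[of "l - t" t] by simp
          show ?thesis unfolding 1 2 3 by (simp add: algebra_simps)
        qed
        also have "sinh (l - t) * sinh t + sinh t * sinh (l - t) \<le> sinh l"
        proof -
          have "sinh (l - t) * sinh t \<le> sinh (l - t) * cosh t"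
            using l t sinh_le_cosh_real[of t] by (intro mult_left_mono) auto
          moreover have "sinh t * sinh (l - t) \<le> sinh t * cosh (l - t)"
            using l t sinh_le_cosh_real[of "l - t"] by (intro mult_left_mono) auto
          moreover have "sinh l = sinh (l - t) * cosh t + cosh (l - t) * sinh t"
            using sinh_add[of "l - t" t] by simp
          ultimately show ?thesis by (simp add: mult.commute)
        qed
        then have "sinh l * cosh D + sinh D * (sinh (l - t) * sinh t + sinh t * sinh (l - t))
            \<le> sinh l * cosh D + sinh D * sinh l"
          using l by (intro add_left_mono mult_left_mono) auto
        also have "\<dots> = sinh l * M" unfolding M_def cosh_plus_sinh[of D, symmetric] by (simp add: algebra_simps)
        finally show ?thesis by simp
      qed
      finally show ?case using sl by (simp add: mult.commute)
    qed
    moreover have "(\<lambda>n. cosh (dist (c t) (g (r n) t))) \<longlonglongrightarrow> cosh (dist (c t) (b t))"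
      by (intro tendsto_intros lim t)
    ultimately show ?thesis by (intro tendsto_upperbound) auto
  qed
  have "dist (c t) (b t) \<le> arcosh M" if "0 \<le> t" for t
  proof -
    have "1 \<le> M" using bound[OF that] cosh_real_ge_1 order_trans by blast
    then have "cosh (dist (c t) (b t)) \<le> cosh (arcosh M)" using bound[OF that] by simp
    then show ?thesis using \<open>1 \<le> M\<close> by (subst (asm) cosh_real_nonneg_le_iff) auto
  qed
  then have "(c, b) \<in> asymptotic_rays" using b c by (auto simp: asymptotic_rays_def)
  then show thesis using that b by blast
qed

text \<open>The quotient of \<open>cosh (dist (b t) (c t)) - 1\<close> by \<open>(sinh t)\<^sup>2\<close> is nondecreasing by the isosceles
  comparison and positive somewhere; this bounds
  \<open>cosh (dist (b s) (c s))\<close> from below by a multiple of \<open>exp (2 * s)\<close>. Equivalently, the Gromov product of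
  distinct ideal points is finite.\<close>

lemma rays_diverge_linearly_common_start:
  fixes b c :: "real \<Rightarrow> 'a::metric_space"
  assumes CAT: "CAT_minus_one (UNIV :: 'a set) dist"
    and b: "geodesic_ray b" and c: "geodesic_ray c" and start: "b 0 = c 0" and "b \<noteq> c"
  obtains R where "\<And>s. 0 \<le> s \<Longrightarrow> 2 * s - R \<le> dist (b s) (c s)"
proof -
  obtain t where "b t \<noteq> c t" using \<open>b \<noteq> c\<close> by blast
  then have t: "0 < t"
    using b c start
    by (cases t "0 :: real" rule: linorder_cases) (auto simp: geodesic_ray_def extensional_def)
  define k where "k = (cosh (dist (b t) (c t)) - 1) / (sinh t)\<^sup>2"
  have "cosh (dist (b t) (c t)) > 1"
    using \<open>b t \<noteq> c t\<close> cosh_real_ge_1[of "dist (b t) (c t)"] by (simp add: less_le)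
  then have k: "k > 0" using t by (simp add: k_def)
  have big: "2 * s + ln (k / 16) \<le> dist (b s) (c s)" if s: "max t 1 \<le> s" for s
  proof -
    have "(cosh (dist (b t) (c t)) - 1) * (sinh s)\<^sup>2 \<le> (sinh t)\<^sup>2 * (cosh (dist (b s) (c s)) - 1)"
      using s t b c start by (intro isosceles_comparison[OF CAT]) (auto intro: isometric_path_ray)
    then have "k * (sinh s)\<^sup>2 \<le> cosh (dist (b s) (c s)) - 1"
      using t by (simp add: k_def field_simps)
    moreover have "cosh (dist (b s) (c s)) \<le> exp (dist (b s) (c s))"
      by (simp add: cosh_def field_simps)
    ultimately have 1: "k * (sinh s)\<^sup>2 \<le> exp (dist (b s) (c s))" by linarith
    \<comment> \<open>From \<open>s \<ge> 1\<close> on, \<open>sinh s\<close> is at least \<open>exp s / 4\<close>; this is the source of the 16.\<close>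
    have "exp 1 \<le> exp s" using s by simp
    then have "2 \<le> exp s" using exp_ge_add_one_self[of 1] by linarith
    moreover have "exp (- s) \<le> 1" using s by simp
    moreover have "e / 4 \<le> (e - x) / 2" if "2 \<le> e" "x \<le> 1" for e x :: real
      using that by (simp add: field_simps)
    ultimately have "exp s / 4 \<le> sinh s" unfolding sinh_field_def by blast
    then have "(exp s / 4)\<^sup>2 \<le> (sinh s)\<^sup>2" by (intro power_mono) auto
    then have "k * (exp s / 4)\<^sup>2 \<le> exp (dist (b s) (c s))"
      using 1 k by (meson mult_left_mono order_trans less_imp_le)
    also have "k * (exp s / 4)\<^sup>2 = exp (2 * s + ln (k / 16))"
      using k by (simp add: exp_add exp_double power_divide)
    finally show ?thesis by simp
  qed
  have "2 * s - max (- ln (k / 16)) (2 * max t 1) \<le> dist (b s) (c s)" if "0 \<le> s" for s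
  proof (cases "max t 1 \<le> s")
    case True then show ?thesis using big[OF True] by linarith
  next
    case False then show ?thesis using zero_le_dist[of "b s" "c s"] by linarith
  qed
  then show thesis using that by blast
qed

lemma equiv_asymptotic_rays: "equiv {c :: real \<Rightarrow> 'a::metric_space. geodesic_ray c} asymptotic_rays"
proof (rule equivI)
  show "asymptotic_rays \<subseteq> {c :: real \<Rightarrow> 'a. geodesic_ray c} \<times> {c. geodesic_ray c}"
    by (auto simp: asymptotic_rays_def)
  show "refl_on {c :: real \<Rightarrow> 'a. geodesic_ray c} asymptotic_rays"
    by (auto simp: refl_on_def asymptotic_rays_def intro: exI[of _ 0])
  show "sym (asymptotic_rays :: ((real \<Rightarrow> 'a) \<times> _) set)"
    by (auto simp: sym_def asymptotic_rays_def dist_commute)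
  show "trans (asymptotic_rays :: ((real \<Rightarrow> 'a) \<times> _) set)"
  proof (rule transI)
    fix a b c :: "real \<Rightarrow> 'a" assume ab: "(a, b) \<in> asymptotic_rays" and bc: "(b, c) \<in> asymptotic_rays"
    obtain B where B: "\<And>t. 0 \<le> t \<Longrightarrow> dist (a t) (b t) \<le> B" using ab by (auto simp: asymptotic_rays_def)
    obtain C where C: "\<And>t. 0 \<le> t \<Longrightarrow> dist (b t) (c t) \<le> C" using bc by (auto simp: asymptotic_rays_def)
    have "dist (a t) (c t) \<le> B + C" if "0 \<le> t" for t
      using B[OF that] C[OF that] dist_triangle[of "a t" "c t" "b t"] by linarith
    then show "(a, c) \<in> asymptotic_rays" using ab bc by (auto simp: asymptotic_rays_def)
  qed
qed

text \<open>Replacing one ray by the asymptotic one that starts at the same point as the other ray changes the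
  distances by a bounded amount only.\<close>

lemma rays_diverge_linearly:
  fixes b c :: "real \<Rightarrow> 'a::heine_borel"
  assumes CAT: "CAT_minus_one (UNIV :: 'a set) dist"
    and b: "geodesic_ray b" and c: "geodesic_ray c" and "(b, c) \<notin> asymptotic_rays"
  obtains R where "\<And>s. 0 \<le> s \<Longrightarrow> 2 * s - R \<le> dist (b s) (c s)"
proof -
  obtain e where ce: "(c, e) \<in> asymptotic_rays" and e0: "e 0 = b 0"
    using ray_from_point[OF CAT c] by metis
  then have e: "geodesic_ray e" by (simp add: asymptotic_rays_def)
  have "b \<noteq> e" using assms(4) ce equiv_asymptotic_rays by (auto simp: equiv_def sym_def)
  obtain R where R: "\<And>s. 0 \<le> s \<Longrightarrow> 2 * s - R \<le> dist (b s) (e s)"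
    using rays_diverge_linearly_common_start[OF CAT b e e0[symmetric] \<open>b \<noteq> e\<close>] by blast
  obtain B where B: "\<And>s. 0 \<le> s \<Longrightarrow> dist (c s) (e s) \<le> B" using ce by (auto simp: asymptotic_rays_def)
  have "2 * s - (R + B) \<le> dist (b s) (c s)" if "0 \<le> s" for s
    using R[OF that] B[OF that] dist_triangle[of "b s" "e s" "c s"] by linarith
  then show thesis using that by blast
qed

lemma ideal_boundary_ray_from:
  fixes p :: "'a::heine_borel"
  assumes CAT: "CAT_minus_one (UNIV :: 'a set) dist" and \<xi>: "\<xi> \<in> ideal_boundary"
  obtains b where "geodesic_ray b" "b 0 = p" "\<xi> = asymptotic_rays `` {b}" "busemann p \<xi> = ray_busemann b"
proof -
  obtain c where c: "geodesic_ray c" "\<xi> = asymptotic_rays `` {c}"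
    using \<xi> by (auto simp: ideal_boundary_def quotient_def)
  obtain b where cb: "(c, b) \<in> asymptotic_rays" and b0: "b 0 = p"
    using ray_from_point[OF CAT c(1)] by blast
  have b: "geodesic_ray b" using cb by (simp add: asymptotic_rays_def)
  have \<xi>b: "\<xi> = asymptotic_rays `` {b}"
    using c(2) equiv_class_eq[OF equiv_asymptotic_rays cb] by simp
  have "(THE c. geodesic_ray c \<and> c 0 = p \<and> c \<in> \<xi>) = b"
  proof (rule the_equality)
    show "geodesic_ray b \<and> b 0 = p \<and> b \<in> \<xi>" using b b0 cb c(2) by blast
    fix e assume "geodesic_ray e \<and> e 0 = p \<and> e \<in> \<xi>"
    then have "(b, e) \<in> asymptotic_rays" "b 0 = e 0" using \<xi>b b0 by auto
    then show "e = b" using ray_unique[OF CAT] by metis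
  qed
  then have "busemann p \<xi> = ray_busemann b" by (simp add: busemann_def)
  then show thesis using that b b0 \<xi>b by blast
qed

text \<open>Since a ray is determined by its starting point and its ideal point, \<open>Omega\<close> can be described by
  rays alone; the base points of the Busemann functions become the starting points.\<close>

lemma mem_Omega_iff:
  fixes F :: "('a::heine_borel \<times> 'a \<Rightarrow> real) set"
  assumes CAT: "CAT_minus_one (UNIV :: 'a set) dist"
  shows "F \<in> Omega \<longleftrightarrow> (\<exists>b c. geodesic_ray b \<and> geodesic_ray c \<and> (b, c) \<notin> asymptotic_rays \<and>
     F = mod_const (\<lambda>(z, z'). max (ray_busemann b z) (ray_busemann c z')))"
proof
  assume "F \<in> Omega"
  then obtain p p' \<xi> \<xi>' where *: "\<xi> \<in> ideal_boundary" "\<xi>' \<in> ideal_boundary" "\<xi> \<noteq> \<xi>'"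
    "F = mod_const (\<lambda>(z, z'). max (busemann p \<xi> z) (busemann p' \<xi>' z'))"
    by (auto simp: Omega_def)
  obtain b where b: "geodesic_ray b" "\<xi> = asymptotic_rays `` {b}" "busemann p \<xi> = ray_busemann b"
    using ideal_boundary_ray_from[OF CAT *(1)] by metis
  obtain c where c: "geodesic_ray c" "\<xi>' = asymptotic_rays `` {c}" "busemann p' \<xi>' = ray_busemann c"
    using ideal_boundary_ray_from[OF CAT *(2)] by metis
  have "(b, c) \<notin> asymptotic_rays"
    using *(3) b(2) c(2) equiv_class_eq[OF equiv_asymptotic_rays] by blast
  then show "\<exists>b c. geodesic_ray b \<and> geodesic_ray c \<and> (b, c) \<notin> asymptotic_rays \<and>
     F = mod_const (\<lambda>(z, z'). max (ray_busemann b z) (ray_busemann c z'))"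
    using b c * by auto
next
  assume "\<exists>b c. geodesic_ray b \<and> geodesic_ray c \<and> (b, c) \<notin> asymptotic_rays \<and>
     F = mod_const (\<lambda>(z, z'). max (ray_busemann b z) (ray_busemann c z'))"
  then obtain b c where *: "geodesic_ray b" "geodesic_ray c" "(b, c) \<notin> asymptotic_rays"
     "F = mod_const (\<lambda>(z, z'). max (ray_busemann b z) (ray_busemann c z'))" by blast
  have base: "asymptotic_rays `` {e} \<in> ideal_boundary \<and> busemann (e 0) (asymptotic_rays `` {e}) = ray_busemann e"
    if e: "geodesic_ray e" for e :: "real \<Rightarrow> 'a"
  proof
    show e': "asymptotic_rays `` {e} \<in> ideal_boundary"
      using e by (auto simp: ideal_boundary_def quotient_def)
    obtain b where b: "b 0 = e 0" "asymptotic_rays `` {e} = asymptotic_rays `` {b}"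
        "busemann (e 0) (asymptotic_rays `` {e}) = ray_busemann b" "geodesic_ray b"
      using ideal_boundary_ray_from[OF CAT e'] by metis
    have "(b, e) \<in> asymptotic_rays"
      using b(2,4) e eq_equiv_class_iff[OF equiv_asymptotic_rays] by fastforce
    then show "busemann (e 0) (asymptotic_rays `` {e}) = ray_busemann e"
      using ray_unique[OF CAT] b by metis
  qed
  have "asymptotic_rays `` {b} \<noteq> asymptotic_rays `` {c}"
    using *(1-3) eq_equiv_class_iff[OF equiv_asymptotic_rays] by fastforce
  then show "F \<in> Omega"
    unfolding Omega_def mem_Collect_eq using *(4) base[OF *(1)] base[OF *(2)]
    by (intro exI[of _ "b 0"] exI[of _ "c 0"] exI[of _ "asymptotic_rays `` {b}"]
        exI[of _ "asymptotic_rays `` {c}"]) simp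
qed


section \<open>Limits of normalized distance functions\<close>

text \<open>Along the diagonal, \<open>max_dist (x, y)\<close> is at least \<open>dist x y / 2\<close>, with equality at a midpoint of
  \<open>x\<close> and \<open>y\<close>. The excess measures by how much \<open>z\<close> fails to be such a minimum.\<close>

definition excess :: "'a::metric_space \<Rightarrow> 'a \<times> 'a \<Rightarrow> real" where
  "excess z p = max_dist p (z, z) - dist (fst p) (snd p) / 2"

definition normalized_dist :: "'a::metric_space \<Rightarrow> 'a \<times> 'a \<Rightarrow> 'a \<times> 'a \<Rightarrow> real" where
  "normalized_dist z p q = max_dist p q - max_dist p (z, z)"

text \<open>The limits of classes of pairs whose midpoint stays near \<open>z\<close>, up to a distance controlled by
  \<open>R\<close>. The additive constants are fixed by the value \<open>0\<close> at \<open>(z, z)\<close>, so that convergence can be taken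
  pointwise.\<close>

definition limit_classes :: "'a::metric_space \<Rightarrow> real \<Rightarrow> ('a \<times> 'a \<Rightarrow> real) set set" where
  "limit_classes z R = {mod_const h | h. \<exists>p. (\<forall>n :: nat. excess z (p n) \<le> R) \<and>
     (\<forall>q. (\<lambda>n. normalized_dist z (p n) q) \<longlonglongrightarrow> h q)}"

lemma limit_classesI:
  assumes "F = mod_const h" "\<And>n :: nat. excess z (p n) \<le> R"
    "\<And>q. (\<lambda>n. normalized_dist z (p n) q) \<longlonglongrightarrow> h q"
  shows "F \<in> limit_classes z R"
  unfolding limit_classes_def mem_Collect_eq
  using assms by (intro exI[of _ h] conjI exI[of _ p] allI)

lemma limit_classesE:
  assumes "F \<in> limit_classes z R"
  obtains h p where "F = mod_const h" "\<And>n :: nat. excess z (p n) \<le> R"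
    "\<And>q. (\<lambda>n. normalized_dist z (p n) q) \<longlonglongrightarrow> h q"
proof -
  from assms obtain h where h: "F = mod_const h \<and>
      (\<exists>p. (\<forall>n :: nat. excess z (p n) \<le> R) \<and> (\<forall>q. (\<lambda>n. normalized_dist z (p n) q) \<longlonglongrightarrow> h q))"
    unfolding limit_classes_def mem_Collect_eq by (rule exE) (rule that)
  from conjunct2[OF this] obtain p where p: "(\<forall>n :: nat. excess z (p n) \<le> R) \<and>
      (\<forall>q. (\<lambda>n. normalized_dist z (p n) q) \<longlonglongrightarrow> h q)"
    by (rule exE) (rule that)
  show thesis
    by (rule that[OF conjunct1[OF h]], rule spec[OF conjunct1[OF p]], rule spec[OF conjunct2[OF p]])
qed

lemma mod_const_cong:
  assumes "\<And>x. f x = g x + a"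
  shows "mod_const f = mod_const g"
proof -
  have "f = (\<lambda>x. g x + a)" using assms by (rule ext)
  then show ?thesis by (simp only: mod_const_add)
qed

lemma max_dist_lipschitz: "\<bar>max_dist p q - max_dist p q'\<bar> \<le> dist q q'"
proof -
  have "dist (fst q) (fst q') \<le> dist q q'" "dist (snd q) (snd q') \<le> dist q q'"
    by (rule dist_fst_le dist_snd_le)+
  then show ?thesis
    using dist_triangle[of "fst p" "fst q" "fst q'"] dist_triangle[of "fst p" "fst q'" "fst q"]
      dist_triangle[of "snd p" "snd q" "snd q'"] dist_triangle[of "snd p" "snd q'" "snd q"]
    by (auto simp: max_dist_def dist_commute abs_le_iff max_def)
qed

lemma max_dist_diag_lipschitz: "max_dist p (w, w) \<le> max_dist p (z, z) + dist w z"
  using dist_triangle[of "fst p" w z] dist_triangle[of "snd p" w z]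
  by (auto simp: max_dist_def dist_commute)

lemma half_dist_le_max_dist: "dist (fst p) (snd p) / 2 \<le> max_dist p (w, w)"
  using dist_triangle[of "fst p" "snd p" w] by (simp add: max_dist_def dist_commute max_def)

lemma excess_lipschitz: "excess w p \<le> excess z p + dist w z"
  using max_dist_diag_lipschitz[of p w z] by (simp add: excess_def)

text \<open>Midpoint contraction applied to the segment between the components of \<open>p\<close>, seen from \<open>z\<close>.\<close>

lemma exists_near_midpoint:
  fixes z :: "'a::metric_space"
  assumes CAT: "CAT_minus_one (UNIV :: 'a set) dist" and R: "excess z p \<le> R"
  shows "\<exists>m. dist m (fst p) = dist (fst p) (snd p) / 2 \<and> dist m (snd p) = dist (fst p) (snd p) / 2 \<and>
    dist z m \<le> arcosh (exp R)"
proof -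
  define a where "a = dist (fst p) (snd p)"
  obtain c where c: "isometric_path a c" "c 0 = fst p" "c a = snd p"
    using CAT_minus_one_geodesic[OF CAT] a_def by metis
  have R0: "0 \<le> R" using R half_dist_le_max_dist[of p z] by (simp add: excess_def)
  have a: "0 \<le> a" by (simp add: a_def)
  have "cosh (dist z (c (a / 2))) * cosh (a / 2) \<le> cosh (max_dist p (z, z))"
    using midpoint_contraction[OF CAT c(1) a, of z] by (simp add: c max_dist_def dist_commute)
  also have "\<dots> \<le> cosh (a / 2 + R)"
    using R a R0 by (subst cosh_real_nonneg_le_iff) (auto simp: excess_def a_def max_dist_def le_max_iff_disj)
  also have "\<dots> = cosh (a / 2) * cosh R + sinh (a / 2) * sinh R" by (rule cosh_add)
  also have "\<dots> \<le> cosh (a / 2) * cosh R + cosh (a / 2) * sinh R"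
    using R0 sinh_le_cosh_real by (intro add_left_mono mult_right_mono) auto
  also have "\<dots> = exp R * cosh (a / 2)" by (simp add: cosh_plus_sinh flip: distrib_left)
  finally have "cosh (dist z (c (a / 2))) \<le> exp R" by simp
  then have "cosh (dist z (c (a / 2))) \<le> cosh (arcosh (exp R))" using R0 by simp
  then have "dist z (c (a / 2)) \<le> arcosh (exp R)"
    using R0 by (subst (asm) cosh_real_nonneg_le_iff) auto
  moreover have "dist (c (a / 2)) (fst p) = a / 2" "dist (c (a / 2)) (snd p) = a / 2"
    using isometric_path_dist_start[OF c(1), of "a / 2"] isometric_path_dist_end[OF c(1), of "a / 2"] a c
    by (auto simp: dist_commute)
  ultimately show ?thesis unfolding a_def by blast
qed

lemma bounded_excess_midpoints:
  fixes z :: "'a::heine_borel"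
  assumes CAT: "CAT_minus_one (UNIV :: 'a set) dist" and R: "\<And>n :: nat. excess z (p n) \<le> R"
  obtains r mm m where "strict_mono (r :: nat \<Rightarrow> nat)" "mm \<longlonglongrightarrow> m"
    "\<And>n. dist (mm n) (fst (p (r n))) = dist (fst (p (r n))) (snd (p (r n))) / 2"
    "\<And>n. dist (mm n) (snd (p (r n))) = dist (fst (p (r n))) (snd (p (r n))) / 2"
proof -
  obtain k where k: "\<And>n. dist (k n) (fst (p n)) = dist (fst (p n)) (snd (p n)) / 2"
    "\<And>n. dist (k n) (snd (p n)) = dist (fst (p n)) (snd (p n)) / 2"
    "\<And>n. dist z (k n) \<le> arcosh (exp R)"
    using exists_near_midpoint[OF CAT R] by metis
  have "seq_compact (cball z (arcosh (exp R)))" by (simp add: compact_imp_seq_compact)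
  moreover have "\<forall>n. k n \<in> cball z (arcosh (exp R))" using k(3) by simp
  ultimately obtain r m where "strict_mono (r :: nat \<Rightarrow> nat)" "(k \<circ> r) \<longlonglongrightarrow> m"
    unfolding seq_compact_def by meson
  then show thesis using that[of r "k \<circ> r" m] k by simp
qed

lemma limit_classes_rebase:
  "limit_classes z R \<subseteq> limit_classes w (R + dist w z)"
proof
  fix F assume "F \<in> limit_classes z R"
  then obtain h p where *: "F = mod_const h" "\<And>n :: nat. excess z (p n) \<le> R"
    "\<And>q. (\<lambda>n. normalized_dist z (p n) q) \<longlonglongrightarrow> h q" by (rule limit_classesE) (rule that)
  have "(\<lambda>n. normalized_dist w (p n) q) \<longlonglongrightarrow> h q - h (w, w)" for q
  proof -
    have "normalized_dist w (p n) q = normalized_dist z (p n) q - normalized_dist z (p n) (w, w)" for n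
      by (simp add: normalized_dist_def)
    then show ?thesis by (simp add: tendsto_diff *)
  qed
  moreover have "excess w (p n) \<le> R + dist w z" for n
    using excess_lipschitz[of w "p n" z] *(2)[of n] by linarith
  moreover have "F = mod_const (\<lambda>q. h q - h (w, w))"
    unfolding *(1) by (rule mod_const_cong[of _ _ "h (w, w)"]) simp
  ultimately show "F \<in> limit_classes w (R + dist w z)" by (intro limit_classesI)
qed

lemma limit_classes_mono:
  assumes "R \<le> R'"
  shows "limit_classes z R \<subseteq> limit_classes z R'"
proof
  fix F assume "F \<in> limit_classes z R"
  then obtain h p where *: "F = mod_const h" "\<And>n :: nat. excess z (p n) \<le> R"
    "\<And>q. (\<lambda>n. normalized_dist z (p n) q) \<longlonglongrightarrow> h q" by (rule limit_classesE) (rule that)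
  from *(2) have "excess z (p n) \<le> R'" for n using assms by (rule order_trans)
  then show "F \<in> limit_classes z R'" by (rule limit_classesI[OF *(1) _ *(3)])
qed

lemma mod_const_action_limit_classes:
  assumes g: "\<And>x y. dist (g x) (g y) = dist x y" and k: "\<And>x. k (g x) = x" "\<And>x. g (k x) = x"
    and F: "mod_const h \<in> limit_classes z R"
  shows "mod_const (h \<circ> map_prod k k) \<in> limit_classes (g z) R"
proof -
  obtain h' p where *: "mod_const h = mod_const h'" "\<And>n :: nat. excess z (p n) \<le> R"
    "\<And>q. (\<lambda>n. normalized_dist z (p n) q) \<longlonglongrightarrow> h' q" using F by (rule limit_classesE) (rule that)
  have "h \<in> mod_const h'" unfolding *(1)[symmetric] by (auto simp: mod_const_def intro: exI[of _ 0])
  then obtain a where "\<And>q. h q = h' q + a" by (auto simp: mod_const_def)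
  then have eq: "mod_const (h \<circ> map_prod k k) = mod_const (h' \<circ> map_prod k k)"
    by (intro mod_const_cong[of _ _ a]) simp
  have md: "max_dist (map_prod g g p) q = max_dist p (map_prod k k q)" for p q
    using g[of "fst p" "k (fst q)"] g[of "snd p" "k (snd q)"] by (simp add: max_dist_def k)
  have nd: "normalized_dist (g z) (map_prod g g p) q = normalized_dist z p (map_prod k k q)" for p q
    by (simp add: normalized_dist_def md k)
  have "excess (g z) (map_prod g g p) = excess z p" for p
    by (simp add: excess_def md k g)
  then have "excess (g z) (map_prod g g (p n)) \<le> R" for n using *(2) by simp
  moreover have "(\<lambda>n. normalized_dist (g z) (map_prod g g (p n)) q) \<longlonglongrightarrow> (h' \<circ> map_prod k k) q" for q
    unfolding nd o_def by (rule *(3))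
  ultimately show ?thesis
    by (rule limit_classesI[OF eq])
qed

lemma bounded_subsequence:
  fixes L :: "nat \<Rightarrow> real"
  assumes "\<not> filterlim L at_top sequentially"
  obtains B r where "strict_mono (r :: nat \<Rightarrow> nat)" "\<And>n. L (r n) \<le> B"
proof -
  obtain B where "\<not> (\<forall>\<^sub>F n in sequentially. B \<le> L n)"
    using assms unfolding filterlim_at_top by blast
  then have "\<exists>n\<ge>m. n \<in> {n. L n \<le> B}" for m
    unfolding eventually_sequentially mem_Collect_eq by (meson linear)
  then have "infinite {n. L n \<le> B}" by (simp add: infinite_nat_iff_unbounded_le)
  from infinite_enumerate[OF this] obtain r where "strict_mono (r :: nat \<Rightarrow> nat)" "\<forall>n. r n \<in> {n. L n \<le> B}" by blast
  then show thesis by (intro that[of r B]) simp_all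
qed

text \<open>Let \<open>m\<close> be a limit of the midpoints of the pairs \<open>(x n, y n)\<close>. The distances from \<open>m\<close> to \<open>x n\<close>
  and to \<open>y n\<close> have a difference tending to 0. If they stay bounded along a subsequence, the pairs
  subconverge in the product. Otherwise the geodesics from \<open>m\<close> to \<open>x n\<close> and to \<open>y n\<close> subconverge to
  rays, and the distance functions to the Busemann functions of these rays, without an extra constant
  between the two. As the geodesics from \<open>m\<close> nearly form one geodesic from \<open>x n\<close> to \<open>y n\<close>, the limit rays
  together form a geodesic line and are not asymptotic.\<close>

lemma limit_classes_subset:
  fixes z :: "'a::heine_borel"
  assumes CAT: "CAT_minus_one (UNIV :: 'a set) dist"
  shows "limit_classes z R \<subseteq> range max_embed \<union> Omega"
proof
  fix F assume "F \<in> limit_classes z R"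
  then obtain h p where F: "F = mod_const h" and exc: "\<And>n :: nat. excess z (p n) \<le> R"
    and h: "\<And>q. (\<lambda>n. normalized_dist z (p n) q) \<longlonglongrightarrow> h q" by (rule limit_classesE) (rule that)
  obtain r mm m where r: "strict_mono (r :: nat \<Rightarrow> nat)" and mm: "mm \<longlonglongrightarrow> m"
    and mid1: "\<And>n. dist (mm n) (fst (p (r n))) = dist (fst (p (r n))) (snd (p (r n))) / 2"
    and mid2: "\<And>n. dist (mm n) (snd (p (r n))) = dist (fst (p (r n))) (snd (p (r n))) / 2"
    by (rule bounded_excess_midpoints[OF CAT exc]) (rule that)
  define x y where "x n = fst (p (r n))" and "y n = snd (p (r n))" for n
  define L L' where "L n = dist m (x n)" and "L' n = dist m (y n)" for n
  have pxy: "p (r n) = (x n, y n)" for n by (simp add: x_def y_def)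
  note mid1 = mid1[folded x_def y_def] and mid2 = mid2[folded x_def y_def]
  have dm: "(\<lambda>n. dist (mm n) m) \<longlonglongrightarrow> 0" by (rule iffD1[OF tendsto_dist_iff mm])
  have near: "\<bar>L n - dist (x n) (y n) / 2\<bar> \<le> dist (mm n) m" "\<bar>L' n - dist (x n) (y n) / 2\<bar> \<le> dist (mm n) m" for n
    using dist_triangle[of m "x n" "mm n"] dist_triangle[of "mm n" "x n" m] mid1[of n]
      dist_triangle[of m "y n" "mm n"] dist_triangle[of "mm n" "y n" m] mid2[of n]
    unfolding L_def L'_def by (simp_all add: dist_commute abs_le_iff)
  have diff: "(\<lambda>n. L' n - L n) \<longlonglongrightarrow> 0"
  proof (rule Lim_null_comparison)
    show "(\<lambda>n. 2 * dist (mm n) m) \<longlonglongrightarrow> 0" using tendsto_mult_left[OF dm, of 2] by simp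
    show "\<forall>\<^sub>F n in sequentially. norm (L' n - L n) \<le> 2 * dist (mm n) m"
      using near by (intro always_eventually allI) (smt (verit) real_norm_def)
  qed
  show "F \<in> range max_embed \<union> Omega"
  proof (cases "filterlim L at_top sequentially")
    case False
    then obtain s B where s: "strict_mono (s :: nat \<Rightarrow> nat)" "\<And>n. L (s n) \<le> B"
      using bounded_subsequence by blast
    obtain C where C: "\<And>n. \<bar>L' n - L n\<bar> \<le> C"
      using BseqE[OF convergent_imp_Bseq[OF convergentI[OF diff]]] unfolding real_norm_def by metis
    have "(x (s n), y (s n)) \<in> cball m B \<times> cball m (B + C)" for n
      using s(2)[of n] C[of "s n"] by (auto simp: L_def L'_def)
    moreover have "seq_compact (cball m B \<times> cball m (B + C))"
      by (intro compact_imp_seq_compact compact_Times compact_cball)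
    ultimately obtain t q0 where t: "strict_mono (t :: nat \<Rightarrow> nat)"
      and q0: "((\<lambda>n. (x (s n), y (s n))) \<circ> t) \<longlonglongrightarrow> q0"
      unfolding seq_compact_def by meson
    have sub: "strict_mono (\<lambda>n. r (s (t n)))" using r s(1) t by (simp add: strict_mono_def)
    have q0': "(\<lambda>n. p (r (s (t n)))) \<longlonglongrightarrow> q0" using q0 by (simp add: o_def pxy)
    have "h q = normalized_dist z q0 q" for q
    proof -
      have "(\<lambda>n. normalized_dist z (p (r (s (t n)))) q) \<longlonglongrightarrow> h q"
        using LIMSEQ_subseq_LIMSEQ[OF h sub] by (simp add: o_def)
      moreover have "(\<lambda>n. normalized_dist z (p (r (s (t n)))) q) \<longlonglongrightarrow> normalized_dist z q0 q"
        unfolding normalized_dist_def max_dist_def by (intro tendsto_intros q0')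
      ultimately show ?thesis by (rule LIMSEQ_unique)
    qed
    then have "F = max_embed q0"
      unfolding F max_embed_def by (intro mod_const_cong[of _ _ "- max_dist q0 (z, z)"]) (simp add: normalized_dist_def)
    then show ?thesis by simp
  next
    case L: True
    have L': "filterlim L' at_top sequentially"
      using filterlim_tendsto_add_at_top[OF diff L] by simp
    have "\<exists>g. isometric_path (L n) g \<and> g 0 = m \<and> g (L n) = x n" for n
      using CAT_minus_one_geodesic[OF CAT, of m "x n"] unfolding L_def by metis
    then obtain g where g: "\<And>n. isometric_path (L n) (g n)" "\<And>n. g n 0 = m" "\<And>n. g n (L n) = x n"
      by metis
    have "\<exists>g. isometric_path (L' n) g \<and> g 0 = m \<and> g (L' n) = y n" for n
      using CAT_minus_one_geodesic[OF CAT, of m "y n"] unfolding L'_def by metis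
    then obtain g' where g': "\<And>n. isometric_path (L' n) (g' n)" "\<And>n. g' n 0 = m" "\<And>n. g' n (L' n) = y n"
      by metis
    obtain s b where s: "strict_mono (s :: nat \<Rightarrow> nat)" and b: "geodesic_ray b" "b 0 = m"
      and lim_s: "\<And>t. 0 \<le> t \<Longrightarrow> (\<lambda>n. g (s n) t) \<longlonglongrightarrow> b t"
      using geodesics_subconverge_to_ray[OF CAT g(1,2) L] by blast
    have "filterlim (\<lambda>n. L' (s n)) at_top sequentially"
      using filterlim_compose[OF L' filterlim_subseq[OF s]] .
    then obtain s' c where s': "strict_mono (s' :: nat \<Rightarrow> nat)" and c: "geodesic_ray c" "c 0 = m"
      and lim_s': "\<And>t. 0 \<le> t \<Longrightarrow> (\<lambda>n. g' (s (s' n)) t) \<longlonglongrightarrow> c t"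
      using geodesics_subconverge_to_ray[OF CAT, of "\<lambda>n. L' (s n)" "\<lambda>n. g' (s n)" m] g' by blast
    define k where "k n = s (s' n)" for n
    have k: "strict_mono k" using s s' by (simp add: k_def strict_mono_def)
    have lim_b: "(\<lambda>n. g (k n) t) \<longlonglongrightarrow> b t" if "0 \<le> t" for t
      using LIMSEQ_subseq_LIMSEQ[OF lim_s[OF that] s'] by (simp add: k_def o_def)
    have lim_c: "(\<lambda>n. g' (k n) t) \<longlonglongrightarrow> c t" if "0 \<le> t" for t
      using lim_s'[OF that] by (simp add: k_def)
    have Lk: "filterlim (\<lambda>n. L (k n)) at_top sequentially" "filterlim (\<lambda>n. L' (k n)) at_top sequentially"
      using filterlim_compose[OF L filterlim_subseq[OF k]] filterlim_compose[OF L' filterlim_subseq[OF k]] .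
    have dk: "(\<lambda>n. L' (k n) - L (k n)) \<longlonglongrightarrow> 0" "(\<lambda>n. dist (mm (k n)) m) \<longlonglongrightarrow> 0"
      using LIMSEQ_subseq_LIMSEQ[OF diff k] LIMSEQ_subseq_LIMSEQ[OF dm k] by (simp_all add: o_def)
    define f where "f = (\<lambda>(w, w'). max (ray_busemann b w) (ray_busemann c w'))"
    have lim_f: "(\<lambda>n. max_dist (p (r (k n))) q - L (k n)) \<longlonglongrightarrow> f q" for q
    proof -
      have "(\<lambda>n. max (dist (fst q) (x (k n)) - L (k n))
              (dist (snd q) (y (k n)) - L' (k n) + (L' (k n) - L (k n))))
          \<longlonglongrightarrow> max (ray_busemann b (fst q)) (ray_busemann c (snd q) + 0)"
      proof (intro tendsto_max tendsto_add dk)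
        show "(\<lambda>n. dist (fst q) (x (k n)) - L (k n)) \<longlonglongrightarrow> ray_busemann b (fst q)"
          using dist_tendsto_ray_busemann[OF CAT g(1) g(2) Lk(1) b(1) lim_b] by (simp add: g)
        show "(\<lambda>n. dist (snd q) (y (k n)) - L' (k n)) \<longlonglongrightarrow> ray_busemann c (snd q)"
          using dist_tendsto_ray_busemann[OF CAT g'(1) g'(2) Lk(2) c(1) lim_c] by (simp add: g')
      qed
      moreover have "max (dist (fst q) (x (k n)) - L (k n))
              (dist (snd q) (y (k n)) - L' (k n) + (L' (k n) - L (k n)))
         = max_dist (p (r (k n))) q - L (k n)" for n
        by (simp add: max_dist_def pxy dist_commute max_def)
      ultimately show ?thesis by (simp add: f_def case_prod_unfold)
    qed
    have "h q = f q - f (z, z)" for q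
    proof -
      have "(\<lambda>n. (max_dist (p (r (k n))) q - L (k n)) - (max_dist (p (r (k n))) (z, z) - L (k n)))
          \<longlonglongrightarrow> f q - f (z, z)" by (intro tendsto_diff lim_f)
      moreover have "strict_mono (\<lambda>n. r (k n))" using r k by (simp add: strict_mono_def)
      then have "(\<lambda>n. normalized_dist z (p (r (k n))) q) \<longlonglongrightarrow> h q"
        using LIMSEQ_subseq_LIMSEQ[OF h] by (simp add: o_def)
      ultimately show ?thesis by (simp add: normalized_dist_def LIMSEQ_unique)
    qed
    then have "F = mod_const f"
      unfolding F by (intro mod_const_cong[of _ _ "- f (z, z)"]) simp
    moreover have "(b, c) \<notin> asymptotic_rays"
    proof
      assume "(b, c) \<in> asymptotic_rays"
      then obtain B where B: "\<And>t. 0 \<le> t \<Longrightarrow> dist (b t) (c t) \<le> B" by (auto simp: asymptotic_rays_def)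
      have "2 * t \<le> dist (b t) (c t)" if t: "0 \<le> t" for t
      proof (rule tendsto_le[OF sequentially_bot])
        show "(\<lambda>n. dist (g (k n) t) (g' (k n) t)) \<longlonglongrightarrow> dist (b t) (c t)"
          by (intro tendsto_dist lim_b lim_c t)
        show "(\<lambda>n. 2 * t - 2 * dist (mm (k n)) m) \<longlonglongrightarrow> 2 * t"
          using tendsto_diff[OF tendsto_const[of "2 * t"] tendsto_mult_left[OF dk(2), of 2]] by simp
        have "\<forall>\<^sub>F n in sequentially. t \<le> L (k n)" "\<forall>\<^sub>F n in sequentially. t \<le> L' (k n)"
          using Lk unfolding filterlim_at_top by blast+
        then show "\<forall>\<^sub>F n in sequentially. 2 * t - 2 * dist (mm (k n)) m \<le> dist (g (k n) t) (g' (k n) t)"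
        proof eventually_elim
          case (elim n)
          have "dist (g (k n) t) (x (k n)) = L (k n) - t" "dist (g' (k n) t) (y (k n)) = L' (k n) - t"
            using isometric_path_dist_end[OF g(1)[of "k n"]] isometric_path_dist_end[OF g'(1)[of "k n"]] elim t g g'
            by auto
          then show ?case
            using dist_triangle[of "x (k n)" "y (k n)" "g (k n) t"]
              dist_triangle[of "g (k n) t" "y (k n)" "g' (k n) t"] near[of "k n"]
            by (simp add: dist_commute abs_le_iff)
        qed
      qed
      moreover have "0 \<le> \<bar>B\<bar> + 1" by simp
      ultimately have "2 * (\<bar>B\<bar> + 1) \<le> B" using B order_trans by blast
      then show False by (smt (verit))
    qed
    ultimately have "F \<in> Omega" using mem_Omega_iff[OF CAT] b(1) c(1) unfolding f_def by blast
    then show ?thesis by simp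
  qed
qed

text \<open>For a pair the point \<open>z\<close> is its midpoint. For \<open>Omega\<close> the pairs \<open>(b n, c n)\<close> on two rays
  approximate the class; because non-asymptotic rays diverge at the maximal rate, the excess of these pairs
  at a fixed point is bounded, so their midpoints subconverge, and \<open>z\<close> is a limit. The bound 1, which
  depends neither on the class nor on \<open>z\<close>, yields cocompactness.\<close>

lemma limit_classes_exhaust:
  fixes F :: "('a::heine_borel \<times> 'a \<Rightarrow> real) set"
  assumes CAT: "CAT_minus_one (UNIV :: 'a set) dist" and F: "F \<in> range max_embed \<union> Omega"
  shows "\<exists>z. F \<in> limit_classes z 1"
proof -
  from F consider p where "F = max_embed p" | "F \<in> Omega" by blast
  then show ?thesis
  proof cases
    case (1 p)
    define a where "a = dist (fst p) (snd p)"
    obtain c where c: "isometric_path a c" "c 0 = fst p" "c a = snd p"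
      using CAT_minus_one_geodesic[OF CAT] a_def by metis
    define m where "m = c (a / 2)"
    have a: "0 \<le> a" by (simp add: a_def)
    then have "excess m p = 0"
      using isometric_path_dist_start[OF c(1), of "a / 2"] isometric_path_dist_end[OF c(1), of "a / 2"] c
      by (simp add: excess_def max_dist_def m_def a_def[symmetric] dist_commute)
    moreover have "F = mod_const (normalized_dist m p)"
      unfolding 1 max_embed_def
      by (rule mod_const_cong[of _ _ "max_dist p (m, m)"]) (simp add: normalized_dist_def)
    ultimately have "F \<in> limit_classes m 1"
      by (intro limit_classesI[of _ "normalized_dist m p" _ "\<lambda>n. p"]) auto
    then show ?thesis by (rule exI)
  next
    case 2
    then obtain b c where b: "geodesic_ray b" and c: "geodesic_ray c" and bc: "(b, c) \<notin> asymptotic_rays"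
      and F: "F = mod_const (\<lambda>(z, z'). max (ray_busemann b z) (ray_busemann c z'))"
      using mem_Omega_iff[OF CAT] by blast
    obtain R where R: "\<And>s. 0 \<le> s \<Longrightarrow> 2 * s - R \<le> dist (b s) (c s)"
      using rays_diverge_linearly[OF CAT b c bc] by blast
    define p where "p n = (b (real n), c (real n))" for n
    have exc: "excess (b 0) (p n) \<le> dist (b 0) (c 0) + R / 2" for n
    proof -
      have "dist (b (real n)) (b 0) = real n" "dist (c 0) (c (real n)) = real n"
        using geodesic_ray_dist[OF b, of "real n" 0] geodesic_ray_dist[OF c, of 0 "real n"] by simp_all
      then have "max_dist (p n) (b 0, b 0) \<le> real n + dist (b 0) (c 0)"
        using dist_triangle[of "b 0" "c (real n)" "c 0"] by (simp add: max_dist_def p_def dist_commute)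
      then show ?thesis using R[of "real n"] by (simp add: excess_def p_def)
    qed
    obtain r mm m where r: "strict_mono (r :: nat \<Rightarrow> nat)" and mm: "mm \<longlonglongrightarrow> m"
      and mid1: "\<And>n. dist (mm n) (fst (p (r n))) = dist (fst (p (r n))) (snd (p (r n))) / 2"
      and mid2: "\<And>n. dist (mm n) (snd (p (r n))) = dist (fst (p (r n))) (snd (p (r n))) / 2"
      by (rule bounded_excess_midpoints[OF CAT exc]) (rule that)
    obtain N where N: "\<And>n. N \<le> n \<Longrightarrow> dist (mm n) m \<le> 1"
      using tendstoD[OF mm, of 1] unfolding eventually_sequentially by (metis less_imp_le zero_less_one)
    \<comment> \<open>Dropping the first \<open>N\<close> pairs, the excess at \<open>m\<close> is at most 1.\<close>
    define k where "k n = r (n + N)" for n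
    have k: "strict_mono k" using r by (simp add: k_def strict_mono_def)
    have "excess m (p (k n)) \<le> 1" for n
    proof -
      have "excess (mm (n + N)) (p (k n)) = 0"
        using mid1[of "n + N"] mid2[of "n + N"] by (simp add: excess_def max_dist_def k_def dist_commute)
      then show ?thesis using excess_lipschitz[of m "p (k n)" "mm (n + N)"] N[of "n + N"]
        by (simp add: dist_commute)
    qed
    moreover define f where "f = (\<lambda>(z, z'). max (ray_busemann b z) (ray_busemann c z'))"
    have lim: "(\<lambda>n. max_dist (p (k n)) q - real (k n)) \<longlonglongrightarrow> f q" for q
    proof -
      have kk: "filterlim (\<lambda>n. real (k n)) at_top sequentially"
        using filterlim_compose[OF filterlim_real_sequentially filterlim_subseq[OF k]] .
      have "(\<lambda>n. max (dist (fst q) (b (real (k n))) - real (k n)) (dist (snd q) (c (real (k n))) - real (k n)))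
          \<longlonglongrightarrow> max (ray_busemann b (fst q)) (ray_busemann c (snd q))"
        by (intro tendsto_max filterlim_compose[OF ray_busemann_tendsto kk] b c)
      moreover have "max (dist (fst q) (b (real (k n))) - real (k n)) (dist (snd q) (c (real (k n))) - real (k n))
          = max_dist (p (k n)) q - real (k n)" for n
        by (simp add: max_dist_def p_def dist_commute max_def)
      ultimately show ?thesis by (simp add: f_def case_prod_unfold)
    qed
    have "(\<lambda>n. normalized_dist m (p (k n)) q) \<longlonglongrightarrow> f q - f (m, m)" for q
      using tendsto_diff[OF lim[of q] lim[of "(m, m)"]] by (simp add: normalized_dist_def)
    moreover have "F = mod_const (\<lambda>q. f q - f (m, m))"
      unfolding F f_def[symmetric] by (rule mod_const_cong[of _ _ "f (m, m)"]) simp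
    ultimately have "F \<in> limit_classes m 1"
      by (intro limit_classesI[of _ "\<lambda>q. f q - f (m, m)" _ "\<lambda>n. p (k n)"])
    then show ?thesis by (rule exI)
  qed
qed


section \<open>Compact sets of limit classes\<close>

text \<open>On 1-Lipschitz functions pointwise convergence is uniform on compact sets: control the values on a
  finite net of \<open>K\<close>.\<close>

lemma lipschitz_pointwise_nbhd:
  fixes f :: "'b::metric_space \<Rightarrow> real"
  assumes f: "1-lipschitz_on UNIV f" and K: "compact K" and e: "e > 0"
  obtains S where "open S" "f \<in> S"
    "\<And>g x. g \<in> S \<Longrightarrow> 1-lipschitz_on UNIV g \<Longrightarrow> x \<in> K \<Longrightarrow> \<bar>g x - f x\<bar> < e"
proof -
  have "K \<subseteq> (\<Union>k\<in>K. ball k (e/3))" using e by auto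
  then obtain N where N: "finite N" "N \<subseteq> K" "K \<subseteq> (\<Union>k\<in>N. ball k (e/3))"
    using compactE_image[OF K, of K "\<lambda>k. ball k (e/3)"] by (metis open_ball)
  define S where "S = (\<Inter>k\<in>N. (\<lambda>g. g k) -` ball (f k) (e/3))"
  show thesis
  proof (rule that[of S])
    show "open S"
      unfolding S_def using N(1) by (intro open_INT ballI open_vimage) auto
    show "f \<in> S" using e by (simp add: S_def)
    fix g x assume g: "g \<in> S" "1-lipschitz_on UNIV g" and x: "x \<in> K"
    obtain k where k: "k \<in> N" "dist k x < e/3" using N x by auto
    have "dist (f k) (g k) < e/3" using g(1) k by (auto simp: S_def)
    moreover have "dist (g k) (g x) \<le> dist k x" "dist (f k) (f x) \<le> dist k x"
      using lipschitz_onD[OF g(2), of k x] lipschitz_onD[OF f, of k x] by simp_all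
    ultimately show "\<bar>g x - f x\<bar> < e" using k(2) unfolding dist_real_def by linarith
  qed
qed

lemma compactin_Cstar_mod_const:
  fixes A :: "('b::metric_space \<Rightarrow> real) set"
  assumes A: "compact A" and lip: "\<And>f. f \<in> A \<Longrightarrow> 1-lipschitz_on UNIV f"
  shows "compactin Cstar (mod_const ` A)"
proof -
  have "continuous_map (top_of_set A) compact_convergence (\<lambda>f. f)"
    unfolding continuous_map
  proof (intro conjI allI impI)
    show "(\<lambda>f. f) ` topspace (top_of_set A) \<subseteq> topspace compact_convergence"
      using lip lipschitz_on_continuous_on by (auto simp: topspace_compact_convergence)
    fix U :: "('b \<Rightarrow> real) set" assume U: "openin compact_convergence U"
    show "openin (top_of_set A) {f \<in> topspace (top_of_set A). f \<in> U}"
    proof (subst openin_subopen, intro ballI)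
      fix f assume "f \<in> {f \<in> topspace (top_of_set A). f \<in> U}"
      then have f: "f \<in> A" "f \<in> U" by auto
      obtain K e where K: "compact K" "e > 0"
        "{g. continuous_on UNIV g \<and> (\<forall>x\<in>K. \<bar>g x - f x\<bar> < e)} \<subseteq> U"
        using U f(2) unfolding openin_compact_convergence by blast
      obtain S where S: "open S" "f \<in> S"
        "\<And>g x. g \<in> S \<Longrightarrow> 1-lipschitz_on UNIV g \<Longrightarrow> x \<in> K \<Longrightarrow> \<bar>g x - f x\<bar> < e"
        using lipschitz_pointwise_nbhd[OF lip[OF f(1)] K(1,2)] by blast
      have "A \<inter> S \<subseteq> U"
      proof
        fix g assume g: "g \<in> A \<inter> S"
        then have "continuous_on UNIV g" using lip lipschitz_on_continuous_on by blast
        moreover have "\<forall>x\<in>K. \<bar>g x - f x\<bar> < e" using S(3) g lip by blast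
        ultimately show "g \<in> U" using K(3) by blast
      qed
      then show "\<exists>T. openin (top_of_set A) T \<and> f \<in> T \<and> T \<subseteq> {f \<in> topspace (top_of_set A). f \<in> U}"
        using S(1,2) f(1) by (intro exI[of _ "A \<inter> S"]) (auto intro: openin_open_Int)
    qed
  qed
  then have "continuous_map (top_of_set A) Cstar mod_const"
    using continuous_map_compose[OF _ quotient_imp_continuous_map[OF quotient_map_mod_const]]
    by (fastforce simp: o_def)
  moreover have "compactin (top_of_set A) A" using A by (simp add: compactin_subtopology)
  ultimately show ?thesis by (rule image_compactin[rotated])
qed

lemma normalized_dist_lipschitz: "1-lipschitz_on UNIV (normalized_dist z p)"
  using max_dist_lipschitz[of p] by (intro lipschitz_onI) (simp_all add: normalized_dist_def dist_real_def)

lemma closed_lipschitz: "closed {f :: 'b::metric_space \<Rightarrow> real. 1-lipschitz_on UNIV f}"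
proof -
  have "{f :: 'b \<Rightarrow> real. 1-lipschitz_on UNIV f} = {f. \<forall>x y. \<bar>f x - f y\<bar> \<le> dist x y}"
    by (auto simp: lipschitz_on_def dist_real_def)
  moreover have "closed {f :: 'b \<Rightarrow> real. \<forall>x y. \<bar>f x - f y\<bar> \<le> dist x y}"
    by (intro closed_Collect_all closed_Collect_le continuous_intros) auto
  ultimately show ?thesis by simp
qed

text \<open>By Tychonoff the closure of the normalized distance functions in the topology of pointwise
  convergence is compact. On 1-Lipschitz functions this topology is as fine as that of uniform convergence
  on compact sets, so the set of their classes is compact too. Sequences suffice to reach every point of the
  closure, because the space is exhausted by the compact balls of integer radius.\<close>

lemma compactin_limit_classes:
  fixes z :: "'a::heine_borel"
  shows "compactin Cstar (limit_classes z R)"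
proof -
  define G where "G = normalized_dist z ` {p. excess z p \<le> R}"
  have "closure G \<subseteq> {h. 1-lipschitz_on UNIV h}"
    by (rule closure_minimal[OF _ closed_lipschitz]) (use normalized_dist_lipschitz in \<open>auto simp only: G_def\<close>)
  then have lip: "1-lipschitz_on UNIV h" if "h \<in> closure G" for h using that by blast
  define B where "B = {h :: 'a \<times> 'a \<Rightarrow> real. \<forall>q. h q \<in> {- dist q (z, z)..dist q (z, z)}}"
  have "compact B" unfolding B_def by (rule compact_pointwise_box) (rule compact_Icc)
  moreover have "closed B"
    unfolding B_def atLeastAtMost_iff
    by (intro closed_Collect_all closed_Collect_conj closed_Collect_le continuous_intros) auto
  moreover have "G \<subseteq> B"
  proof
    fix h assume "h \<in> G"
    then obtain p where h: "h = normalized_dist z p" by (auto simp: G_def)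
    have "- dist q (z, z) \<le> h q \<and> h q \<le> dist q (z, z)" for q
      using max_dist_lipschitz[of p q "(z, z)"] unfolding h normalized_dist_def by linarith
    then show "h \<in> B" unfolding B_def atLeastAtMost_iff by blast
  qed
  ultimately have "compact (closure G)"
    using compact_Int_closed[of B "closure G"] closure_minimal[of G B] by (simp add: inf.absorb2)
  then have "compactin Cstar (mod_const ` closure G)"
    using lip by (rule compactin_Cstar_mod_const)
  moreover have "mod_const ` closure G = limit_classes z R"
  proof (intro equalityI subsetI)
    fix F assume "F \<in> limit_classes z R"
    then obtain h p where *: "F = mod_const h" "\<And>n :: nat. excess z (p n) \<le> R"
      "\<And>q. (\<lambda>n. normalized_dist z (p n) q) \<longlonglongrightarrow> h q" by (rule limit_classesE) (rule that)
    have "limitin (product_topology (\<lambda>i. euclidean) UNIV) (\<lambda>n. normalized_dist z (p n)) h sequentially"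
      unfolding limitin_componentwise using *(3) by simp
    then have "(\<lambda>n. normalized_dist z (p n)) \<longlonglongrightarrow> h" by (simp add: euclidean_product_topology)
    then have "h \<in> closure G"
      using *(2) closure_subset[of G]
      by (intro Lim_in_closed_set[OF closed_closure]) (auto simp: G_def intro!: always_eventually)
    then show "F \<in> mod_const ` closure G" using *(1) by blast
  next
    fix F assume "F \<in> mod_const ` closure G"
    then obtain h where h: "h \<in> closure G" "F = mod_const h" by blast
    have "\<exists>p. excess z p \<le> R \<and> (\<forall>q\<in>cball (z, z) (real n). \<bar>normalized_dist z p q - h q\<bar> < 1 / real (Suc n))" for n
    proof -
      obtain S where S: "open S" "h \<in> S"
        "\<And>g x. g \<in> S \<Longrightarrow> 1-lipschitz_on UNIV g \<Longrightarrow> x \<in> cball (z, z) (real n) \<Longrightarrow> \<bar>g x - h x\<bar> < 1 / real (Suc n)"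
        using lipschitz_pointwise_nbhd[OF lip[OF h(1)] compact_cball, of "1 / real (Suc n)" "(z, z)" "real n"]
        by (metis of_nat_0_less_iff zero_less_Suc zero_less_divide_1_iff)
      have "S \<inter> G \<noteq> {}" using S h(1) open_Int_closure_eq_empty[OF S(1), of G] by blast
      then obtain p where "excess z p \<le> R" "normalized_dist z p \<in> S" by (auto simp: G_def)
      then show ?thesis using S(3) normalized_dist_lipschitz by blast
    qed
    then obtain p where p: "\<And>n. excess z (p n) \<le> R"
      "\<And>n q. q \<in> cball (z, z) (real n) \<Longrightarrow> \<bar>normalized_dist z (p n) q - h q\<bar> < 1 / real (Suc n)" by metis
    have "(\<lambda>n. normalized_dist z (p n) q) \<longlonglongrightarrow> h q" for q
    proof -
      obtain N where N: "dist (z, z) q \<le> real N" using real_arch_simple by blast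
      have "(\<lambda>n. normalized_dist z (p n) q - h q) \<longlonglongrightarrow> 0"
      proof (rule Lim_null_comparison)
        show "(\<lambda>n. 1 / real (Suc n)) \<longlonglongrightarrow> 0" by real_asymp
        show "\<forall>\<^sub>F n in sequentially. norm (normalized_dist z (p n) q - h q) \<le> 1 / real (Suc n)"
          using eventually_ge_at_top[of N]
        proof eventually_elim
          case (elim n)
          then have "q \<in> cball (z, z) (real n)" using N by (simp add: order_trans[OF N])
          from p(2)[OF this] show ?case by simp
        qed
      qed
      then show ?thesis by (simp add: LIM_zero_iff)
    qed
    then show "F \<in> limit_classes z R" by (intro limit_classesI[OF h(2) p(1)])
  qed
  ultimately show ?thesis by simp
qed


section \<open>Convexity of limit classes along the diagonal\<close>

lemma limit_class_representative:
  assumes "F \<in> limit_classes z R" "h \<in> F"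
  obtains p a where "\<And>n :: nat. excess z (p n) \<le> R" "\<And>q. (\<lambda>n. max_dist (p n) q - a n) \<longlonglongrightarrow> h q"
proof -
  obtain h' p where *: "F = mod_const h'" "\<And>n :: nat. excess z (p n) \<le> R"
    "\<And>q. (\<lambda>n. normalized_dist z (p n) q) \<longlonglongrightarrow> h' q" using assms(1) by (rule limit_classesE) (rule that)
  obtain a where a: "\<And>q. h q = h' q + a" using assms(2) by (auto simp: *(1) mod_const_def)
  have "(\<lambda>n. max_dist (p n) q - (max_dist (p n) (z, z) - a)) \<longlonglongrightarrow> h q" for q
    using tendsto_add[OF *(3)[of q] tendsto_const[of a]] by (simp add: normalized_dist_def a algebra_simps)
  then show thesis by (rule that[OF *(2)])
qed

text \<open>Midpoint contraction in logarithmic form. The two components share the midpoint of the diagonal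
  segment, so the maximum inherits the estimate; the constant comes from \<open>exp x / 2 \<le> cosh x \<le> exp x\<close>.
  In this form the inequality is invariant under adding constants and survives pointwise limits.\<close>

lemma max_dist_midpoint:
  fixes u w :: "'a::metric_space"
  assumes CAT: "CAT_minus_one (UNIV :: 'a set) dist"
    and c: "isometric_path (dist u w) c" "c 0 = u" "c (dist u w) = w"
  shows "max_dist p (c (dist u w / 2), c (dist u w / 2)) + ln (cosh (dist u w / 2))
    \<le> max (max_dist p (u, u)) (max_dist p (w, w)) + ln 2"
proof -
  define m M where "m = c (dist u w / 2)" and "M = max (max_dist p (u, u)) (max_dist p (w, w))"
  have M: "max (dist x u) (dist x w) \<le> M" if "x = fst p \<or> x = snd p" for x
    using that by (auto simp: M_def max_dist_def)
  have x: "dist x m + ln (cosh (dist u w / 2)) \<le> M + ln 2" if "x = fst p \<or> x = snd p" for x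
  proof -
    have M0: "0 \<le> M" by (rule order_trans[OF _ M[OF that]]) (simp add: le_max_iff_disj)
    have "exp (dist x m) / 2 * cosh (dist u w / 2) \<le> cosh (dist x m) * cosh (dist u w / 2)"
      by (intro mult_right_mono) (simp_all add: cosh_field_def)
    also have "\<dots> \<le> cosh (max (dist x u) (dist x w))"
      using midpoint_contraction[OF CAT c(1), of x] by (simp add: c(2,3) m_def)
    also have "\<dots> \<le> cosh M" using M[OF that] M0 by (subst cosh_real_nonneg_le_iff) (auto simp: le_max_iff_disj)
    also have "\<dots> \<le> cosh M + sinh M" using M0 by simp
    also have "\<dots> = exp M" by (rule cosh_plus_sinh)
    finally have "exp (dist x m) * cosh (dist u w / 2) \<le> 2 * exp M" by simp
    then have "ln (exp (dist x m) * cosh (dist u w / 2)) \<le> ln (2 * exp M)"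
      by (subst ln_le_cancel_iff) auto
    then show ?thesis by (simp add: ln_mult)
  qed
  show ?thesis
    using x[of "fst p"] x[of "snd p"] unfolding m_def[symmetric] M_def[symmetric] by (simp add: max_dist_def)
qed

lemma limit_class_midpoint:
  fixes z :: "'a::metric_space"
  assumes CAT: "CAT_minus_one (UNIV :: 'a set) dist" and F: "F \<in> limit_classes z R" "h \<in> F"
  obtains m where "h (m, m) + ln (cosh (dist u w / 2)) \<le> max (h (u, u)) (h (w, w)) + ln 2"
proof -
  obtain c where c: "isometric_path (dist u w) c" "c 0 = u" "c (dist u w) = w"
    using CAT_minus_one_geodesic[OF CAT] by blast
  define m where "m = c (dist u w / 2)"
  obtain p a where h: "\<And>q. (\<lambda>n. max_dist (p n) q - a n) \<longlonglongrightarrow> h q"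
    by (rule limit_class_representative[OF F]) (rule that)
  have "h (m, m) + ln (cosh (dist u w / 2)) \<le> max (h (u, u)) (h (w, w)) + ln 2"
  proof (rule tendsto_le[OF sequentially_bot])
    show "(\<lambda>n. max_dist (p n) (m, m) - a n + ln (cosh (dist u w / 2))) \<longlonglongrightarrow> h (m, m) + ln (cosh (dist u w / 2))"
      by (intro tendsto_add h tendsto_const)
    show "(\<lambda>n. max (max_dist (p n) (u, u) - a n) (max_dist (p n) (w, w) - a n) + ln 2)
        \<longlonglongrightarrow> max (h (u, u)) (h (w, w)) + ln 2"
      by (intro tendsto_add tendsto_max h tendsto_const)
    have "max_dist (p n) (m, m) - a n + ln (cosh (dist u w / 2))
        \<le> max (max_dist (p n) (u, u) - a n) (max_dist (p n) (w, w) - a n) + ln 2" for n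
      using max_dist_midpoint[OF CAT c, of "p n"] unfolding m_def[symmetric] by (simp add: max_def split: if_splits)
    then show "\<forall>\<^sub>F n in sequentially. max_dist (p n) (m, m) - a n + ln (cosh (dist u w / 2))
        \<le> max (max_dist (p n) (u, u) - a n) (max_dist (p n) (w, w) - a n) + ln 2"
      by (intro always_eventually allI)
  qed
  then show thesis by (rule that)
qed

lemma limit_class_quasi_convex:
  fixes z :: "'a::metric_space"
  assumes CAT: "CAT_minus_one (UNIV :: 'a set) dist" and F: "F \<in> limit_classes z R" "h \<in> F"
    and t: "0 \<le> t" "t \<le> dist u w"
  obtains v where "dist u v = t" "h (v, v) \<le> max (h (u, u)) (h (w, w))"
proof -
  obtain c where c: "isometric_path (dist u w) c" "c 0 = u" "c (dist u w) = w"
    using CAT_minus_one_geodesic[OF CAT] by blast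
  define v where "v = c t"
  have duv: "dist u v = t" using isometric_path_dist_start[OF c(1) t] by (simp add: c v_def)
  obtain p a where h: "\<And>q. (\<lambda>n. max_dist (p n) q - a n) \<longlonglongrightarrow> h q"
    by (rule limit_class_representative[OF F]) (rule that)
  have "h (v, v) \<le> max (h (u, u)) (h (w, w))"
  proof (rule tendsto_le[OF sequentially_bot])
    show "(\<lambda>n. max_dist (p n) (v, v) - a n) \<longlonglongrightarrow> h (v, v)" by (rule h)
    show "(\<lambda>n. max (max_dist (p n) (u, u) - a n) (max_dist (p n) (w, w) - a n))
        \<longlonglongrightarrow> max (h (u, u)) (h (w, w))"
      by (intro tendsto_max h)
    have "max_dist (p n) (v, v) - a n \<le> max (max_dist (p n) (u, u) - a n) (max_dist (p n) (w, w) - a n)" for n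
      using dist_quasi_convex[OF CAT c(1) t, of "fst (p n)"] dist_quasi_convex[OF CAT c(1) t, of "snd (p n)"]
      by (auto simp: c v_def[symmetric] max_dist_def)
    then show "\<forall>\<^sub>F n in sequentially. max_dist (p n) (v, v) - a n
        \<le> max (max_dist (p n) (u, u) - a n) (max_dist (p n) (w, w) - a n)"
      by (intro always_eventually allI)
  qed
  with duv show thesis by (rule that)
qed

lemma limit_class_lower_bound:
  assumes F: "F \<in> limit_classes z R" "h \<in> F"
  shows "h (z, z) - R \<le> h (w, w)"
proof -
  obtain p a where exc: "\<And>n :: nat. excess z (p n) \<le> R" and h: "\<And>q. (\<lambda>n. max_dist (p n) q - a n) \<longlonglongrightarrow> h q"
    by (rule limit_class_representative[OF F]) (rule that)
  have "max_dist (p n) (z, z) - a n - R \<le> max_dist (p n) (w, w) - a n" for n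
    using exc[of n] half_dist_le_max_dist[of "p n" w] by (simp add: excess_def)
  then show ?thesis
    by (intro tendsto_le[OF sequentially_bot h tendsto_diff[OF h tendsto_const]] always_eventually allI)
qed

lemma limit_class_diag_lipschitz:
  assumes F: "F \<in> limit_classes z R" "h \<in> F"
  shows "h (u, u) - dist u w \<le> h (w, w)"
proof -
  obtain p a where h: "\<And>q. (\<lambda>n. max_dist (p n) q - a n) \<longlonglongrightarrow> h q"
    by (rule limit_class_representative[OF F]) (rule that)
  have "max_dist (p n) (u, u) - a n - dist u w \<le> max_dist (p n) (w, w) - a n" for n
    using max_dist_diag_lipschitz[of "p n" u w] by simp
  then show ?thesis
    by (intro tendsto_le[OF sequentially_bot h tendsto_diff[OF h tendsto_const]] always_eventually allI)
qed


section \<open>Open sets of classes with a minimum near a given point\<close>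

text \<open>By quasi-convexity, a limit class satisfying this condition takes its minimum along the diagonal
  inside the ball of radius \<open>r\<close> about \<open>z\<close>. As the condition concerns compact sets of points only, it
  is open.\<close>

definition descends_inside :: "'a::metric_space \<Rightarrow> real \<Rightarrow> ('a \<times> 'a \<Rightarrow> real) set set" where
  "descends_inside z r = {F \<in> topspace Cstar. \<forall>h\<in>F. \<forall>w. dist z w = r \<longrightarrow> h (z, z) < h (w, w)}"

lemma openin_descends_inside:
  fixes z :: "'a::heine_borel"
  shows "openin Cstar (descends_inside z r)"
  unfolding openin_Cstar
proof
  show "descends_inside z r \<subseteq> mod_const ` {f. continuous_on UNIV f}"
    by (auto simp: descends_inside_def topspace_Cstar)
  show "openin compact_convergence {f. continuous_on UNIV f \<and> mod_const f \<in> descends_inside z r}"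
    unfolding openin_compact_convergence
  proof (intro conjI ballI)
    show "{f. continuous_on UNIV f \<and> mod_const f \<in> descends_inside z r} \<subseteq> {f. continuous_on UNIV f}" by blast
    have iff: "mod_const g \<in> descends_inside z r \<longleftrightarrow> (\<forall>w. dist z w = r \<longrightarrow> g (z, z) < g (w, w))"
      if "continuous_on UNIV g" for g
    proof -
      have "mod_const g \<in> topspace Cstar" using that by (auto simp: topspace_Cstar)
      moreover have "(\<forall>h\<in>mod_const g. \<forall>w. dist z w = r \<longrightarrow> h (z, z) < h (w, w)) \<longleftrightarrow>
          (\<forall>w. dist z w = r \<longrightarrow> g (z, z) < g (w, w))"
        by (auto simp: mod_const_def)
      ultimately show ?thesis by (simp add: descends_inside_def)
    qed
    fix f assume "f \<in> {f. continuous_on UNIV f \<and> mod_const f \<in> descends_inside z r}"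
    then have f: "continuous_on UNIV f" "\<And>w. dist z w = r \<Longrightarrow> f (z, z) < f (w, w)"
      using iff by auto
    have "closed (sphere z r)"
      unfolding sphere_def by (intro closed_Collect_eq continuous_intros)
    then have comp: "compact (sphere z r)"
      unfolding compact_eq_bounded_closed by (intro conjI bounded_subset[OF bounded_cball sphere_cball])
    obtain e where e: "e > 0" "\<And>w. dist z w = r \<Longrightarrow> f (z, z) + e \<le> f (w, w)"
    proof (cases "sphere z r = {}")
      case True
      then have "dist z w \<noteq> r" for w by (metis empty_iff mem_sphere)
      then show thesis by (intro that[of 1]) simp_all
    next
      case False
      have "continuous_on (sphere z r) (\<lambda>w. f (w, w))"
        by (rule continuous_on_compose2[OF f(1)]) (auto intro!: continuous_intros)
      then obtain w0 where w0: "w0 \<in> sphere z r" "\<And>w. w \<in> sphere z r \<Longrightarrow> f (w0, w0) \<le> f (w, w)"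
        using continuous_attains_inf[OF comp False] by blast
      show thesis
      proof (rule that[of "f (w0, w0) - f (z, z)"])
        show "0 < f (w0, w0) - f (z, z)" using w0(1) f(2)[of w0] by simp
        show "f (z, z) + (f (w0, w0) - f (z, z)) \<le> f (w, w)" if "dist z w = r" for w
          using w0(2)[of w] that by simp
      qed
    qed
    define K where "K = (\<lambda>w. (w, w)) ` insert z (sphere z r)"
    have "compact K"
      unfolding K_def by (intro compact_continuous_image compact_insert comp continuous_intros)
    moreover have "g \<in> {f. continuous_on UNIV f \<and> mod_const f \<in> descends_inside z r}"
      if g: "continuous_on UNIV g" "\<forall>x\<in>K. \<bar>g x - f x\<bar> < e / 2" for g
    proof -
      have "g (z, z) < g (w, w)" if "dist z w = r" for w
      proof -
        have "\<bar>g (z, z) - f (z, z)\<bar> < e / 2" "\<bar>g (w, w) - f (w, w)\<bar> < e / 2"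
          using g(2) that by (auto simp: K_def)
        then show ?thesis using e(2)[OF that] by linarith
      qed
      then show ?thesis using iff[OF g(1)] g(1) by blast
    qed
    ultimately show "\<exists>K e. compact K \<and> 0 < e \<and> {g. continuous_on UNIV g \<and> (\<forall>x\<in>K. \<bar>g x - f x\<bar> < e)}
        \<subseteq> {f. continuous_on UNIV f \<and> mod_const f \<in> descends_inside z r}"
      using e(1) by (intro exI[of _ K] exI[of _ "e / 2"]) auto
  qed
qed

lemma ln_cosh_ge: "x - ln 2 \<le> ln (cosh (x :: real))"
proof -
  have "ln (exp x / 2) \<le> ln (cosh x)"
    by (subst ln_le_cancel_iff) (auto simp: cosh_field_def intro: add_pos_pos)
  then show ?thesis by (simp add: ln_div)
qed

text \<open>The diagonal values are bounded below. Were they on the sphere about \<open>u\<close> no larger than at \<open>u\<close>,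
  midpoint contraction would yield a value smaller than at \<open>u\<close> by about half the radius.\<close>

lemma exists_descends_inside:
  fixes z :: "'a::heine_borel"
  assumes CAT: "CAT_minus_one (UNIV :: 'a set) dist" and F: "F \<in> limit_classes z R"
  shows "\<exists>n :: nat. F \<in> descends_inside u (real n)"
proof -
  obtain h where Fh: "F = mod_const h"
    using F by (rule limit_classesE) (rule that)
  have hF: "h \<in> F" by (auto simp: Fh mod_const_def intro: exI[of _ 0])
  obtain n where n: "2 * (h (u, u) - h (z, z) + R + 2 * ln 2) < real n" using reals_Archimedean2 by blast
  have "h (u, u) < h (w, w)" if w: "dist u w = real n" for w
  proof (rule ccontr)
    assume "\<not> h (u, u) < h (w, w)"
    moreover obtain m where "h (m, m) + ln (cosh (dist u w / 2)) \<le> max (h (u, u)) (h (w, w)) + ln 2"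
      by (rule limit_class_midpoint[OF CAT F hF]) (rule that)
    ultimately show False
      using limit_class_lower_bound[OF F hF, of m] ln_cosh_ge[of "dist u w / 2"] n w by simp
  qed
  moreover have "F \<in> topspace Cstar"
    using compactin_subset_topspace[OF compactin_limit_classes] F by blast
  ultimately have "F \<in> descends_inside u (real n)"
    by (auto simp: descends_inside_def Fh mod_const_def)
  then show ?thesis by blast
qed

text \<open>Beyond the sphere, quasi-convexity prevents the values from dropping below the value at the
  centre; inside it the Lipschitz condition suffices.\<close>

lemma descends_inside_lower_bound:
  fixes z :: "'a::metric_space"
  assumes CAT: "CAT_minus_one (UNIV :: 'a set) dist" and F: "F \<in> limit_classes z R" "h \<in> F"
    and r: "F \<in> descends_inside u r" "0 \<le> r"
  shows "h (u, u) - r \<le> h (w, w)"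
proof (cases "dist u w \<le> r")
  case True
  then show ?thesis using limit_class_diag_lipschitz[OF F, of u w] by simp
next
  case False
  then obtain v where v: "dist u v = r" "h (v, v) \<le> max (h (u, u)) (h (w, w))"
    using limit_class_quasi_convex[OF CAT F r(2), of u w] by auto
  have "h (u, u) < h (v, v)" using r(1) v(1) F(2) by (auto simp: descends_inside_def)
  then show ?thesis using v(2) r(2) by linarith
qed

lemma isometry_group_inverse:
  assumes "g \<in> carrier isometry_group"
  shows "dist (g x) (g y) = dist x y" "inv_into UNIV g (g x) = x" "g (inv_into UNIV g x) = x"
    "dist (inv_into UNIV g x) (inv_into UNIV g y) = dist x y"
proof -
  have g: "surj g" "\<And>x y. dist (g x) (g y) = dist x y" using assms by (auto simp: isometry_group_def)
  have "inj g"
  proof (rule injI)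
    fix x y assume "g x = g y"
    then show "x = y" using g(2)[of x y] by simp
  qed
  show "dist (g x) (g y) = dist x y" by (rule g(2))
  show "inv_into UNIV g (g x) = x" using \<open>inj g\<close> by (rule inv_f_f)
  show inv: "g (inv_into UNIV g x) = x" for x using g(1) by (rule surj_f_inv_f)
  show "dist (inv_into UNIV g x) (inv_into UNIV g y) = dist x y"
    using g(2)[of "inv_into UNIV g x" "inv_into UNIV g y"] by (simp only: inv)
qed

section \<open>The action on the product together with Omega\<close>

theorem theorem3:
  fixes \<Gamma> :: "('a::heine_borel \<Rightarrow> 'a) set"
  assumes "CAT_minus_one (UNIV :: 'a set) dist"
    and "\<not> compact (UNIV :: 'a set)"
    and "subgroup \<Gamma> isometry_group"
    and "properly_discontinuous euclidean \<Gamma> (\<lambda>\<gamma> x. \<gamma> x)"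
    and "cocompact euclidean \<Gamma> (\<lambda>\<gamma> x. \<gamma> x)"
  shows "properly_discontinuous
           (subtopology Cstar (range max_embed \<union> Omega :: ('a \<times> 'a \<Rightarrow> real) set set))
           \<Gamma> diag_action
       \<and> cocompact
           (subtopology Cstar (range max_embed \<union> Omega :: ('a \<times> 'a \<Rightarrow> real) set set))
           \<Gamma> diag_action"
proof
  note CAT = assms(1)
  let ?A = "range max_embed \<union> Omega :: ('a \<times> 'a \<Rightarrow> real) set set"
  have iso: "g \<in> carrier isometry_group" if "g \<in> \<Gamma>" for g
    using assms(3) that subgroup.subset by blast
  note exhaust = limit_classes_exhaust[OF CAT]
  define u :: 'a where "u = undefined"

  show "properly_discontinuous (subtopology Cstar ?A) \<Gamma> diag_action"
    unfolding properly_discontinuous_def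
  proof (intro allI impI)
    fix K assume "compactin (subtopology Cstar ?A) K"
    then have K: "compactin Cstar K" "K \<subseteq> ?A" by (simp_all add: compactin_subtopology)
    have "K \<subseteq> \<Union>(range (\<lambda>n :: nat. descends_inside u (real n)))"
    proof
      fix F assume "F \<in> K"
      then obtain z where "F \<in> limit_classes z 1" using exhaust[OF subsetD[OF K(2) \<open>F \<in> K\<close>]] by blast
      from exists_descends_inside[OF CAT this, of u]
      show "F \<in> \<Union>(range (\<lambda>n :: nat. descends_inside u (real n)))" by blast
    qed
    then have "\<exists>T. finite T \<and> T \<subseteq> range (\<lambda>n :: nat. descends_inside u (real n)) \<and> K \<subseteq> \<Union>T"
      using openin_descends_inside[of u] by (intro compactinD[OF K(1)]) auto
    then obtain T where T: "finite T" "T \<subseteq> range (\<lambda>n :: nat. descends_inside u (real n))" "K \<subseteq> \<Union>T"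
      by (elim exE conjE) (rule that)
    from finite_subset_image[OF T(1,2)]
    obtain I where I: "finite I" "T = (\<lambda>n :: nat. descends_inside u (real n)) ` I" by (elim exE conjE) (rule that)
    obtain N where N: "\<And>n. n \<in> I \<Longrightarrow> n \<le> N" using I(1) unfolding finite_nat_set_iff_bounded_le by blast
    \<comment> \<open>The sets of the cover are not nested, but the lower bounds that they give are.\<close>
    have low: "h (u, u) - real N \<le> h (w, w)" if "F \<in> K" "h \<in> F" for F h w
    proof -
      have "F \<in> (\<Union>n\<in>I. descends_inside u (real n))" using T(3) \<open>F \<in> K\<close> unfolding I(2) by (rule subsetD)
      then obtain n where n: "n \<le> N" "F \<in> descends_inside u (real n)" using N by blast
      obtain z where "F \<in> limit_classes z 1" using exhaust[OF subsetD[OF K(2) \<open>F \<in> K\<close>]] by blast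
      from descends_inside_lower_bound[OF CAT this \<open>h \<in> F\<close> n(2), of w] n(1) show ?thesis by simp
    qed
    \<comment> \<open>If \<open>F\<close> lies in \<open>K\<close> and in its translate by \<open>g\<close>, its diagonal values at \<open>u\<close> and at \<open>g u\<close> both are
      within \<open>N\<close> of the infimum. Midpoint contraction between these two points bounds their distance.\<close>
    define D where "D = 2 * (real N + 2 * ln 2)"
    have "cball u D \<inter> g ` cball u D \<noteq> {}" if g: "g \<in> \<Gamma>" "K \<inter> diag_action g ` K \<noteq> {}" for g
    proof -
      note gi = isometry_group_inverse[OF iso[OF g(1)]]
      let ?k = "inv_into UNIV g"
      obtain F' where F': "F' \<in> K" "diag_action g F' \<in> K" using g(2) by blast
      obtain z where "F' \<in> limit_classes z 1" using exhaust[OF subsetD[OF K(2) F'(1)]] by blast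
      then obtain h' where F'h: "F' = mod_const h'" by (rule limit_classesE) (rule that)
      have h': "h' \<in> F'" by (auto simp: F'h mod_const_def intro: exI[of _ 0])
      define h where "h = h' \<circ> map_prod ?k ?k"
      have h: "h \<in> diag_action g F'" using h' by (simp add: diag_action_def h_def)
      have low_u: "h (u, u) - real N \<le> h (w, w)" for w by (rule low[OF F'(2) h])
      have low_gu: "h (g u, g u) - real N \<le> h (w, w)" for w
        using low[OF F'(1) h', of "?k w"] by (simp add: h_def gi)
      obtain z' where z': "diag_action g F' \<in> limit_classes z' 1"
        using exhaust[OF subsetD[OF K(2) F'(2)]] by (rule exE) (rule that)
      obtain m where "h (m, m) + ln (cosh (dist u (g u) / 2)) \<le> max (h (u, u)) (h (g u, g u)) + ln 2"
        by (rule limit_class_midpoint[OF CAT z' h]) (rule that)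
      moreover have "max (h (u, u)) (h (g u, g u)) - real N \<le> h (m, m)"
        using low_u[of m] low_gu[of m] by (simp add: max_def)
      ultimately have "dist u (g u) / 2 \<le> real N + 2 * ln 2"
        using ln_cosh_ge[of "dist u (g u) / 2"] by linarith
      then have "dist u (g u) \<le> D" by (simp add: D_def)
      moreover have "0 \<le> D" by (simp add: D_def)
      ultimately have "g u \<in> cball u D" "u \<in> cball u D" by simp_all
      then show ?thesis by blast
    qed
    then have "{g \<in> \<Gamma>. K \<inter> diag_action g ` K \<noteq> {}} \<subseteq> {g \<in> \<Gamma>. cball u D \<inter> g ` cball u D \<noteq> {}}" by blast
    moreover have "finite {g \<in> \<Gamma>. cball u D \<inter> g ` cball u D \<noteq> {}}"
      using assms(4) by (simp add: properly_discontinuous_def)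
    ultimately show "finite {g \<in> \<Gamma>. K \<inter> diag_action g ` K \<noteq> {}}" by (rule finite_subset)
  qed

  obtain B where B: "compact B" "UNIV = (\<Union>g\<in>\<Gamma>. g ` B)"
    using assms(5) by (auto simp: cocompact_def)
  obtain D where D: "\<And>b. b \<in> B \<Longrightarrow> dist u b \<le> D"
    using compact_imp_bounded[OF B(1)] bounded_any_center[of B u] by blast
  \<comment> \<open>The group moves a class with a near minimum at \<open>z\<close> to one with a near minimum in \<open>B\<close>.\<close>
  define K where "K = limit_classes u (1 + D)"
  have into: "diag_action g F \<in> ?A" if gF: "g \<in> \<Gamma>" "F \<in> K" for g F
  proof -
    obtain h where F: "F = mod_const h" using gF(2) unfolding K_def by (rule limit_classesE) (rule that)
    note gi = isometry_group_inverse[OF iso[OF gF(1)]]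
    have "diag_action g F \<in> limit_classes (g u) (1 + D)"
      unfolding F diag_action_mod_const
      by (rule mod_const_action_limit_classes) (use gF(2) gi in \<open>simp_all add: K_def F\<close>)
    then show ?thesis by (rule subsetD[OF limit_classes_subset[OF CAT]])
  qed
  have cover: "F \<in> (\<Union>g\<in>\<Gamma>. diag_action g ` K)" if FA: "F \<in> ?A" for F
  proof -
    obtain z where z: "F \<in> limit_classes z 1" using exhaust[OF FA] by blast
    then obtain h where F: "F = mod_const h" by (rule limit_classesE) (rule that)
    obtain g b where g: "g \<in> \<Gamma>" "b \<in> B" "z = g b" using B(2) by blast
    note gi = isometry_group_inverse[OF iso[OF g(1)]]
    have "mod_const (h \<circ> map_prod g g) \<in> limit_classes (inv_into UNIV g z) 1"
      by (rule mod_const_action_limit_classes) (use z gi in \<open>simp_all add: F\<close>)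
    also have "inv_into UNIV g z = b" by (simp add: g(3) gi)
    also have "limit_classes b 1 \<subseteq> limit_classes u (1 + dist u b)" by (rule limit_classes_rebase)
    also have "\<dots> \<subseteq> K" unfolding K_def using D[OF g(2)] by (intro limit_classes_mono) simp
    finally have "mod_const (h \<circ> map_prod g g) \<in> K" .
    moreover have "h \<circ> map_prod g g \<circ> map_prod (inv_into UNIV g) (inv_into UNIV g) = h"
      by (auto simp: fun_eq_iff gi)
    then have "diag_action g (mod_const (h \<circ> map_prod g g)) = F"
      unfolding diag_action_mod_const F by simp
    ultimately show ?thesis using g(1) by blast
  qed
  have "?A \<subseteq> topspace Cstar"
  proof
    fix F assume "F \<in> ?A"
    from exhaust[OF this] obtain z where "F \<in> limit_classes z 1" by blast
    then show "F \<in> topspace Cstar" by (rule subsetD[OF compactin_subset_topspace[OF compactin_limit_classes]])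
  qed
  then have "topspace (subtopology Cstar ?A) = ?A" by (simp add: inf.absorb2)
  also have "?A = (\<Union>g\<in>\<Gamma>. diag_action g ` K)"
  proof (rule equalityI)
    show "?A \<subseteq> (\<Union>g\<in>\<Gamma>. diag_action g ` K)" using cover by (rule subsetI)
    show "(\<Union>g\<in>\<Gamma>. diag_action g ` K) \<subseteq> ?A" by (intro UN_least image_subsetI into)
  qed
  finally have "topspace (subtopology Cstar ?A) = (\<Union>g\<in>\<Gamma>. diag_action g ` K)" .
  moreover have "compactin (subtopology Cstar ?A) K"
    unfolding compactin_subtopology K_def by (intro conjI compactin_limit_classes limit_classes_subset[OF CAT])
  ultimately show "cocompact (subtopology Cstar ?A) \<Gamma> diag_action"
    unfolding cocompact_def by blast
qed

end
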